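(* Let $H(\mathbf{S})=(H_2(\mathbf{S}),\dots,H_n(\mathbf{S}))$ be the system described in the context, of maximal total degree $N$ in $\mathbf{S}$, and let $\tilde{\mathbf{s}}\in(\pi\,\widehat{R((t))})^{n-1}$ be the unique solution of $H(\mathbf{S})=0$. Let $\mathrm{Jac}_H(0)$ be the Jacobian matrix of $H$ with respect to $\mathbf{S}$ at $\mathbf{S}=0$. (1) Suppose there are positive integers $a,b$ and integers $d_0,\dots,d_N$ such that the coefficients of the homogeneous parts of degree $l$ (in $\mathbf{S}$) of $H(\mathbf{S})$ are in $\pi^a t^{-d_0}R[[t]]$ for $l=0$, in $R+\pi^b t^{-d_1}R[[t]]$ for $l=1$, and in $t^{-d_l}R[[t]]$ for $l=2,\dots,N$, and such that the determinant of $\mathrm{Jac}_H(0)$ is in $R^*+\pi^b t^{-d_1}R[[t]]$. Then for every $\nu\in\mathbb{Q}_{>0}$ with $\nu<a$, the coordinates of $\tilde{\mathbf{s}}$ are in $R_{\alpha_\nu,\frac{\nu}{e}}((t))$, where $$\alpha_\nu=\frac1e\,{\min}^+\left\{\frac{b}{d_1},\ \frac{a-\nu}{d_0},\ \frac{\nu}{d_2},\ \frac{2\nu}{d_3},\ \dots,\ \frac{(N-1)\nu}{d_N}\right\}.$$ (2) Let $\alpha\in\mathbb{Q}_{>0}$. Suppose instead that there are positive integers $a,b$ and integers $d_0,\dots,d_N$ such that the coefficients of the homogeneous parts of degree $l$ of $H(\mathbf{S})$ are in $\pi^aR_{\alpha,-d_0\alpha}((t))$ for $l=0$, in $R+\pi^bR_{\alpha,-d_1\alpha}((t))$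 for $l=1$, and in $R_{\alpha,-d_l\alpha}((t))$ for $l=2,\dots,N$, and that the determinant of $\mathrm{Jac}_H(0)$ is in $R^*+\pi^bR_{\alpha,-d_1\alpha}((t))$. Then for every $\nu\in\mathbb{Q}_{>0}$ with $\nu<a$, the coordinates of $\tilde{\mathbf{s}}$ are in $R_{\min\{\alpha,\alpha_\nu\},\frac{\nu}{e}}((t))$, with $\alpha_\nu$ given by the same formula as in (1).
   Context: $K$ is a finite Galois extension of $\mathbb{Q}_p$ with ramification index $e$, valuation ring $R$, uniformizer $\pi$, residue field $k=R/\pi R$, and valuation $v$ normalized by $v(p)=1$; $\sigma$ is an automorphism of $K$ inducing $x\mapsto x^{p'}$ on $k$, with $p'$ a positive power of $p$. $\widehat{R((t))}=\{\sum_{m\in\mathbb{Z}}a_mt^m : a_m\in R,\ \lim_{m\to-\infty}a_m=0\}$ is the $\pi$-adic completion of $R((t))$. For rational $\alpha>0$ and $\beta$, $$R_{\alpha,\beta}((t))=\Bigl\{\sum_{m\in\mathbb{Z}}a_mt^m : a_m\in R,\ v(a_m)\ge-\alpha m+\beta \text{ for all } m\Bigr\}.$$ For a finite set $T\subset\mathbb{R}\cup\{\infty\}$, ${\min}^+(T)=\min(T\cap\mathbb{R}_{>0})$, i.e. negative numbers and $\infty$ are ignored; an entry with denominator $0$ counts as $\infty$. If no positive real entries remain (all $d_l\le 0$), then $\alpha_\nu=+\infty$, and the conclusion is read as holding for arbitrarily large rational values in place of $\alpha_\nu$. Setting. $C\to\mathrm{Spec}(R)$ is a proper, smooth curve with geometrically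 irreducible fibres. $X=\mathrm{Spec}(A)$ is a Zariski open affine in $C$ containing the generic point of the special fibre $C_k$, where $A=R[\mathbf{x}]/(f_2,\dots,f_n)$, $\mathbf{x}=(x_1,\dots,x_n)$, and the determinants of the $(n-1)\times(n-1)$ minors of the reduction modulo $\pi$ of the Jacobian matrix $\mathrm{Jac}_f$ of $f=(f_2,\dots,f_n)$ generate the unit ideal of $A\otimes_Rk$. After a finite extension of the base, $C\setminus X$ is a union of distinct sections; $Q:\mathrm{Spec}(R)\to C$ is one of these (the base having already been enlarged so that $Q$ is defined over $R$). $P$ ($n\times(n-1)$) and $\Delta^2,\dots,\Delta^n$ ($(n-1)\times(n-1)$) are matrices over $R[\mathbf{x}]$ with $\mathrm{Jac}_f\cdot P\equiv\mathrm{Id}_{n-1}+\sum_{j=2}^nf_j\Delta^j$ modulo $\pi$. $R\langle\mathbf{x}\rangle$ is the ring of power series over $R$ with coefficients tending to $0$, $\psi$ is its $\sigma$-linear endomorphism with $\psi(x_i)=x_i^{p'}$, the superscript $\sigma$ means applying $\sigma$ to coefficients, and, with $\mathbf{S}=(S_2,\dots,S_n)$ a column vector of variables, $$G(\mathbf{S})=f^{\sigma}\bigl(\psi(\mathbf{x})+\psi(P)\mathbf{S}\bigr)-f^{p'}-\sum_{j=2}^n f_j^{p'}\,\psi(\Delta^j)\,\mathbf{S}$$ with $f^\sigma=(f_2^\sigma,\dots,f_n^\sigma)$, $f^{p'}=(f_2^{p'},\dots,f_n^{p'})$. Expansion map $\xi$: let $q$ be the image of the closed point under $Q$ and $t\in\mathcal{O}_{C,q}$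 a local equation of $Q$; the $(t)$-adic completion of $\mathcal{O}_{C,q}$ is $R[[t]]$. For $a\in A$ choose $h\in\mathcal{O}_{C,q}$, not restricting to $0$ on $C_k$, with $ha\in\mathcal{O}_{C,q}$; the image $u$ of $h$ in $\widehat{R((t))}$ is a unit, and $\xi(a)$ is $u^{-1}$ times the image of $ha$. This extends by $\pi$-adic completeness to $\xi:R\langle\mathbf{x}\rangle\to\widehat{R((t))}$ factoring through $R\langle\mathbf{x}\rangle/(f_2,\dots,f_n)$. $H(\mathbf{S})$ is obtained from $G(\mathbf{S})$ by applying $\xi$ to its coefficients; it is known that $H(\mathbf{S})=0$ has a unique solution $\tilde{\mathbf{s}}$ in $(\pi\,\widehat{R((t))})^{n-1}$. *)

theory Defs
  imports
    "HOL-Library.Extended_Real"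
    "HOL-Library.Poly_Mapping"
    "HOL-Combinatorics.Permutations"
    "HOL-Analysis.Abstract_Topology"
    "HOL-Algebra.Embedded_Algebras"
    "HOL-Algebra.Algebraic_Closure_Type"
begin

section \<open>The base field\<close>

abbreviation whole_ring :: "'a::ring_1 ring"
  where "whole_ring \<equiv> ring_of_type_algebra"

abbreviation ring_on :: "'a::ring_1 set \<Rightarrow> 'a ring"
  where "ring_on S \<equiv> whole_ring\<lparr>carrier := S\<rparr>"

definition is_valuation :: "('k::field \<Rightarrow> ereal) \<Rightarrow> bool" where
  "is_valuation v \<longleftrightarrow>
     (\<forall>x. v x = \<infinity> \<longleftrightarrow> x = 0) \<and> (\<forall>x. v x \<noteq> -\<infinity>) \<and>
     (\<forall>x y. v (x * y) = v x + v y) \<and> (\<forall>x y. min (v x) (v y) \<le> v (x + y))"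

definition val_tendsto :: "('k::field \<Rightarrow> ereal) \<Rightarrow> (nat \<Rightarrow> 'k) \<Rightarrow> 'k \<Rightarrow> bool" where
  "val_tendsto v z l \<longleftrightarrow> ((\<lambda>n. v (z n - l)) \<longlongrightarrow> \<infinity>) sequentially"

definition val_lim :: "('k::field \<Rightarrow> ereal) \<Rightarrow> (nat \<Rightarrow> 'k) \<Rightarrow> 'k" where
  "val_lim v z = (THE l. val_tendsto v z l)"

definition val_Cauchy :: "('k::field \<Rightarrow> ereal) \<Rightarrow> (nat \<Rightarrow> 'k) \<Rightarrow> bool" where
  "val_Cauchy v z \<longleftrightarrow> (\<forall>c::real. \<exists>N. \<forall>m\<ge>N. \<forall>n\<ge>N. ereal c \<le> v (z m - z n))"

text \<open>A subfield \<open>L\<close> is a copy of the field of \<open>p\<close>-adic numbers if it is a completion of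
  the rationals: \<open>v\<close> restricts to the \<open>p\<close>-adic valuation on the rationals, these are dense
  in \<open>L\<close>, and \<open>L\<close> is complete.\<close>

definition is_padic_numbers :: "nat \<Rightarrow> ('k::field_char_0 \<Rightarrow> ereal) \<Rightarrow> 'k set \<Rightarrow> bool" where
  "is_padic_numbers p v L \<longleftrightarrow>
     subfield L whole_ring \<and>
     (\<forall>m::int. m \<noteq> 0 \<longrightarrow> v (of_int m) = ereal (real (multiplicity (int p) m))) \<and>
     (\<forall>x\<in>L. \<exists>z. (\<forall>n. z n \<in> \<rat>) \<and> val_tendsto v z x) \<and>
     (\<forall>z. (\<forall>n. z n \<in> L) \<and> val_Cauchy v z \<longrightarrow> (\<exists>x\<in>L. val_tendsto v z x))"

definition finite_Galois_over :: "'k::field set \<Rightarrow> bool" where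
  "finite_Galois_over L \<longleftrightarrow>
     ring.finite_dimension whole_ring L (UNIV :: 'k set) \<and>
     {x. \<forall>\<tau>\<in>ring_iso whole_ring whole_ring. (\<forall>y\<in>L. \<tau> y = y) \<longrightarrow> \<tau> x = x} = L"

definition padic_Galois_field :: "nat \<Rightarrow> ('k::field_char_0 \<Rightarrow> ereal) \<Rightarrow> bool" where
  "padic_Galois_field p v \<longleftrightarrow>
     prime p \<and> is_valuation v \<and> v (of_nat p) = 1 \<and>
     (\<exists>L. is_padic_numbers p v L \<and> finite_Galois_over L)"

definition val_ring :: "('k::field \<Rightarrow> ereal) \<Rightarrow> 'k set" where
  "val_ring v = {x. 0 \<le> v x}"

definition is_uniformizer :: "('k::field \<Rightarrow> ereal) \<Rightarrow> 'k \<Rightarrow> bool" where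
  "is_uniformizer v \<pi> \<longleftrightarrow> \<pi> \<noteq> 0 \<and> {x. 0 < v x} = (\<lambda>r. \<pi> * r) ` val_ring v"

text \<open>\<open>red\<close> presents the type \<open>'r\<close> as the residue field; its values outside the valuation
  ring are irrelevant.\<close>

definition is_residue_map :: "('k::field \<Rightarrow> ereal) \<Rightarrow> 'k \<Rightarrow> ('k \<Rightarrow> 'r::field) \<Rightarrow> bool" where
  "is_residue_map v \<pi> red \<longleftrightarrow>
     red \<in> ring_hom (ring_on (val_ring v)) whole_ring \<and>
     red ` val_ring v = UNIV \<and>
     {x \<in> val_ring v. red x = 0} = (\<lambda>r. \<pi> * r) ` val_ring v"


section \<open>Polynomials in finitely many variables\<close>

type_synonym 'a mpoly = "(nat \<Rightarrow>\<^sub>0 nat) \<Rightarrow>\<^sub>0 'a"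

definition mconst :: "'a \<Rightarrow> 'a::zero mpoly" where
  "mconst c = Poly_Mapping.single 0 c"

definition mvar :: "nat \<Rightarrow> 'a::zero_neq_one mpoly" where
  "mvar i = Poly_Mapping.single (Poly_Mapping.single i 1) 1"

definition polys :: "'a::zero set \<Rightarrow> nat set \<Rightarrow> 'a mpoly set" where
  "polys S V = {g. (\<forall>u. Poly_Mapping.lookup g u \<in> S) \<and> (\<forall>u\<in>Poly_Mapping.keys g. Poly_Mapping.keys u \<subseteq> V)}"

definition meval :: "('a::zero \<Rightarrow> 'b::comm_ring_1) \<Rightarrow> (nat \<Rightarrow> 'b) \<Rightarrow> 'a mpoly \<Rightarrow> 'b" where
  "meval \<phi> y g = (\<Sum>u\<in>Poly_Mapping.keys g. \<phi> (Poly_Mapping.lookup g u) * (\<Prod>i\<in>Poly_Mapping.keys u. y i ^ Poly_Mapping.lookup u i))"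

definition mpderiv :: "nat \<Rightarrow> 'a::comm_ring_1 mpoly \<Rightarrow> 'a mpoly" where
  "mpderiv i g =
     (\<Sum>u\<in>Poly_Mapping.keys g. Poly_Mapping.single (u - Poly_Mapping.single i 1)
                    (of_nat (Poly_Mapping.lookup u i) * Poly_Mapping.lookup g u))"

definition total_deg :: "(nat \<Rightarrow>\<^sub>0 nat) \<Rightarrow> nat" where
  "total_deg u = (\<Sum>i\<in>Poly_Mapping.keys u. Poly_Mapping.lookup u i)"

definition rdet :: "('a, 'm) ring_scheme \<Rightarrow> nat set \<Rightarrow> (nat \<Rightarrow> nat \<Rightarrow> 'a) \<Rightarrow> 'a" where
  "rdet S I M =
     (\<Oplus>\<^bsub>S\<^esub>\<tau>\<in>{\<tau>. \<tau> permutes I}.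
        (if evenperm \<tau> then \<one>\<^bsub>S\<^esub> else \<ominus>\<^bsub>S\<^esub> \<one>\<^bsub>S\<^esub>) \<otimes>\<^bsub>S\<^esub> (\<Otimes>\<^bsub>S\<^esub>i\<in>I. M i (\<tau> i)))"

text \<open>The Jacobian matrix of \<open>g\<^sub>2, \<dots>, g\<^sub>m\<close> has rows \<open>2, \<dots>, m\<close> and columns \<open>1, \<dots>, m\<close>. For
  each \<open>c\<close> the maximal minor that omits column \<open>c\<close> is indexed by \<open>2, \<dots>, m\<close> on both sides.\<close>

definition max_minors :: "nat \<Rightarrow> (nat \<Rightarrow> 'a::comm_ring_1 mpoly) \<Rightarrow> 'a mpoly set" where
  "max_minors m g =
     (\<lambda>c. rdet whole_ring {2..m} (\<lambda>i j. mpderiv (if j \<le> c then j - 1 else j) (g i))) ` {1..m}"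

definition minors_generate_unit_ideal ::
    "'a::comm_ring_1 set \<Rightarrow> nat \<Rightarrow> (nat \<Rightarrow> 'a mpoly) \<Rightarrow> bool" where
  "minors_generate_unit_ideal S m g \<longleftrightarrow>
     1 \<in> Idl\<^bsub>ring_on (polys S {1..m})\<^esub> (g ` {2..m} \<union> max_minors m g)"


section \<open>Curves\<close>

text \<open>
  An integral separated scheme is represented, following Chevalley, Zariski and Grothendieck
  (EGA I, section 8), by the set \<open>C\<close> of its local rings inside its function field \<open>'f\<close>. The
  points are the elements of \<open>C\<close>, the stalk at a point \<open>P\<close> is the ring \<open>P\<close> itself, and the
  sections over an open set are the intersection of the stalks. A scheme that is proper and
  smooth over a discrete valuation ring and has geometrically irreducible fibres is integral
  and separated, so nothing is lost. The field embedding \<open>\<iota>\<close> from \<open>K\<close> to \<open>'f\<close> is the structure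
  morphism.
\<close>

definition nonunits :: "'f::field set \<Rightarrow> 'f set" where
  "nonunits P = P - Units (ring_on P)"

definition loc :: "'f::field set \<Rightarrow> 'f set \<Rightarrow> 'f set" where
  "loc A \<pp> = {a / b | a b. a \<in> A \<and> b \<in> A - \<pp>}"

definition spec :: "'f::field set \<Rightarrow> 'f set set" where
  "spec A = {loc A \<pp> | \<pp>. primeideal \<pp> (ring_on A)}"

text \<open>The \<open>R\<close>-subalgebra generated by \<open>y\<^sub>1, \<dots>, y\<^sub>m\<close>.\<close>

definition subalgebra ::
    "('k::field \<Rightarrow> ereal) \<Rightarrow> ('k \<Rightarrow> 'f::field) \<Rightarrow> nat \<Rightarrow> (nat \<Rightarrow> 'f) \<Rightarrow> 'f set" where
  "subalgebra v \<iota> m y = meval \<iota> y ` polys (val_ring v) {1..m}"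

definition relations ::
    "('k::field \<Rightarrow> ereal) \<Rightarrow> ('k \<Rightarrow> 'f::field) \<Rightarrow> nat \<Rightarrow> (nat \<Rightarrow> 'f) \<Rightarrow> 'k mpoly set" where
  "relations v \<iota> m y = {g \<in> polys (val_ring v) {1..m}. meval \<iota> y g = 0}"

text \<open>\<open>R[y\<^sub>1, \<dots>, y\<^sub>m]\<close> is presented as \<open>R[x\<^sub>1, \<dots>, x\<^sub>m]/(g\<^sub>2, \<dots>, g\<^sub>m)\<close>.\<close>

definition presented_by ::
    "('k::field \<Rightarrow> ereal) \<Rightarrow> ('k \<Rightarrow> 'f::field) \<Rightarrow> nat \<Rightarrow> (nat \<Rightarrow> 'f) \<Rightarrow> (nat \<Rightarrow> 'k mpoly) \<Rightarrow> bool" where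
  "presented_by v \<iota> m y g \<longleftrightarrow>
     (\<forall>j\<in>{2..m}. g j \<in> polys (val_ring v) {1..m}) \<and>
     relations v \<iota> m y = Idl\<^bsub>ring_on (polys (val_ring v) {1..m})\<^esub> (g ` {2..m})"

definition valuation_subring :: "'f::field set \<Rightarrow> bool" where
  "valuation_subring V \<longleftrightarrow> subring V whole_ring \<and> (\<forall>x. x \<in> V \<or> inverse x \<in> V)"

definition dominates :: "'f::field set \<Rightarrow> 'f set \<Rightarrow> bool" where
  "dominates V P \<longleftrightarrow> P \<subseteq> V \<and> nonunits P \<subseteq> nonunits V"

definition finite_type_model ::
    "('k::field \<Rightarrow> ereal) \<Rightarrow> ('k \<Rightarrow> 'f::field) \<Rightarrow> 'f set set \<Rightarrow> bool" where
  "finite_type_model v \<iota> C \<longleftrightarrow>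
     (\<exists>\<A>. finite \<A> \<and> \<A> \<noteq> {} \<and> C = (\<Union>A\<in>\<A>. spec A) \<and>
       (\<forall>A\<in>\<A>. (\<exists>m y. A = subalgebra v \<iota> m y) \<and> {a / b | a b. a \<in> A \<and> b \<in> A} = UNIV))"

text \<open>The valuative criteria, for valuation rings of the function field: existence and
  uniqueness of centres.\<close>

definition separated_model :: "'f::field set set \<Rightarrow> bool" where
  "separated_model C \<longleftrightarrow>
     (\<forall>V P P'. valuation_subring V \<and> P \<in> C \<and> P' \<in> C \<and> dominates V P \<and> dominates V P' \<longrightarrow> P = P')"

definition proper_model ::
    "('k::field \<Rightarrow> ereal) \<Rightarrow> ('k \<Rightarrow> 'f::field) \<Rightarrow> 'f set set \<Rightarrow> bool" where
  "proper_model v \<iota> C \<longleftrightarrow>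
     finite_type_model v \<iota> C \<and> separated_model C \<and>
     (\<forall>V. valuation_subring V \<and> \<iota> ` val_ring v \<subseteq> V \<longrightarrow> (\<exists>P\<in>C. dominates V P))"

definition zariski :: "'f::field set set \<Rightarrow> 'f set topology" where
  "zariski C = topology_generated_by {{P \<in> C. x \<in> P} | x. True}"

text \<open>An affine open subscheme of \<open>C\<close> with chosen generators \<open>y\<^sub>1, \<dots>, y\<^sub>m\<close> of its coordinate ring.\<close>

definition affine_open ::
    "('k::field \<Rightarrow> ereal) \<Rightarrow> ('k \<Rightarrow> 'f::field) \<Rightarrow> 'f set set \<Rightarrow> nat \<Rightarrow> (nat \<Rightarrow> 'f) \<Rightarrow> bool" where
  "affine_open v \<iota> C m y \<longleftrightarrow> openin (zariski C) (spec (subalgebra v \<iota> m y))"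

text \<open>Smooth of relative dimension one, by the Jacobian criterion.\<close>

definition smooth_curve ::
    "('k::field \<Rightarrow> ereal) \<Rightarrow> ('k \<Rightarrow> 'f::field) \<Rightarrow> 'f set set \<Rightarrow> bool" where
  "smooth_curve v \<iota> C \<longleftrightarrow>
     (\<forall>P\<in>C. \<exists>m y g. 1 \<le> m \<and> affine_open v \<iota> C m y \<and> P \<in> spec (subalgebra v \<iota> m y) \<and>
        presented_by v \<iota> m y g \<and> minors_generate_unit_ideal (val_ring v) m g)"

text \<open>
  A geometric point of \<open>Spec(R)\<close> is given by a homomorphism \<open>\<tau>\<close> from \<open>R\<close> to an algebraically
  closed field. The geometric fibre of \<open>Spec(R[y\<^sub>1, \<dots>, y\<^sub>m])\<close> over it is cut out in affine
  space by the ideal \<open>geometric_fibre_ideal v \<iota> \<tau> m y\<close>; it is empty iff this is the unit ideal, and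
  irreducible iff the radical of the ideal is prime. The fibre of \<open>C\<close> is irreducible iff the
  fibres of affine opens are not all empty, are irreducible when nonempty, and pairwise meet
  when nonempty.
\<close>

definition geometric_fibre_ideal ::
    "('k::field \<Rightarrow> ereal) \<Rightarrow> ('k \<Rightarrow> 'f::field) \<Rightarrow> ('k \<Rightarrow> 'c::field) \<Rightarrow> nat \<Rightarrow> (nat \<Rightarrow> 'f) \<Rightarrow> 'c mpoly set" where
  "geometric_fibre_ideal v \<iota> \<tau> m y =
     Idl\<^bsub>ring_on (polys UNIV {1..m})\<^esub> (Poly_Mapping.map \<tau> ` relations v \<iota> m y)"

definition geometric_fibre_nonempty ::
    "('k::field \<Rightarrow> ereal) \<Rightarrow> ('k \<Rightarrow> 'f::field) \<Rightarrow> ('k \<Rightarrow> 'c::field) \<Rightarrow> nat \<Rightarrow> (nat \<Rightarrow> 'f) \<Rightarrow> bool" where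
  "geometric_fibre_nonempty v \<iota> \<tau> m y \<longleftrightarrow> 1 \<notin> geometric_fibre_ideal v \<iota> \<tau> m y"

definition irreducible_geometric_fibre ::
    "('k::field \<Rightarrow> ereal) \<Rightarrow> ('k \<Rightarrow> 'f::field) \<Rightarrow> 'f set set \<Rightarrow> ('k \<Rightarrow> 'c::field) \<Rightarrow> bool" where
  "irreducible_geometric_fibre v \<iota> C \<tau> \<longleftrightarrow>
     (\<exists>m y. affine_open v \<iota> C m y \<and> geometric_fibre_nonempty v \<iota> \<tau> m y) \<and>
     (\<forall>m y. affine_open v \<iota> C m y \<and> geometric_fibre_nonempty v \<iota> \<tau> m y \<longrightarrow>
        (let J = geometric_fibre_ideal v \<iota> \<tau> m y in
         \<forall>g \<in> polys UNIV {1..m}. \<forall>h \<in> polys UNIV {1..m}.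
           (\<exists>r. (g * h) ^ r \<in> J) \<longrightarrow> (\<exists>r. g ^ r \<in> J) \<or> (\<exists>r. h ^ r \<in> J))) \<and>
     (\<forall>m y m' y'.
        affine_open v \<iota> C m y \<and> geometric_fibre_nonempty v \<iota> \<tau> m y \<and>
        affine_open v \<iota> C m' y' \<and> geometric_fibre_nonempty v \<iota> \<tau> m' y' \<longrightarrow>
        (\<exists>l z. affine_open v \<iota> C l z \<and> geometric_fibre_nonempty v \<iota> \<tau> l z \<and>
           spec (subalgebra v \<iota> l z) \<subseteq>
             spec (subalgebra v \<iota> m y) \<inter> spec (subalgebra v \<iota> m' y')))"

definition geometrically_irreducible_fibres ::
    "('k::field \<Rightarrow> ereal) \<Rightarrow> ('k \<Rightarrow> 'r::field) \<Rightarrow> ('k \<Rightarrow> 'f::field) \<Rightarrow> 'f set set \<Rightarrow> bool" where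
  "geometrically_irreducible_fibres v red \<iota> C \<longleftrightarrow>
     irreducible_geometric_fibre v \<iota> C (to_ac :: 'k \<Rightarrow> 'k alg_closure) \<and>
     irreducible_geometric_fibre v \<iota> C (\<lambda>x. to_ac (red x) :: 'r alg_closure)"

definition special_fibre :: "('k::field \<Rightarrow> 'f::field) \<Rightarrow> 'k \<Rightarrow> 'f set set \<Rightarrow> 'f set set" where
  "special_fibre \<iota> \<pi> C = {P \<in> C. \<iota> \<pi> \<in> nonunits P}"

text \<open>A section \<open>Spec(R) \<rightarrow> C\<close>: the image \<open>q\<close> of the closed point together with the local
  homomorphism of \<open>R\<close>-algebras from the stalk at \<open>q\<close> to \<open>R\<close>. The image of the generic point is
  the localisation of \<open>q\<close> at the kernel.\<close>

definition is_section ::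
    "('k::field \<Rightarrow> ereal) \<Rightarrow> ('k \<Rightarrow> 'f::field) \<Rightarrow> 'f set set \<Rightarrow> 'f set \<Rightarrow> ('f \<Rightarrow> 'k) \<Rightarrow> bool" where
  "is_section v \<iota> C q ev \<longleftrightarrow>
     q \<in> C \<and> ev \<in> ring_hom (ring_on q) (ring_on (val_ring v)) \<and>
     (\<forall>r\<in>val_ring v. ev (\<iota> r) = r) \<and> (\<forall>x\<in>nonunits q. 0 < v (ev x))"

definition section_kernel :: "'f::field set \<Rightarrow> ('f \<Rightarrow> 'k::field) \<Rightarrow> 'f set" where
  "section_kernel q ev = {x \<in> q. ev x = 0}"

definition section_image :: "'f::field set \<Rightarrow> ('f \<Rightarrow> 'k::field) \<Rightarrow> 'f set set" where
  "section_image q ev = {q, loc q (section_kernel q ev)}"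


section \<open>Laurent series and the expansion map\<close>

text \<open>A series \<open>\<Sum> a\<^sub>m t\<^sup>m\<close> is given by its coefficient function. Its coefficients tend to \<open>0\<close>
  at minus infinity, so the two-sided sums that define a product converge.\<close>

definition lhat :: "('k::field \<Rightarrow> ereal) \<Rightarrow> (int \<Rightarrow> 'k) set" where
  "lhat v = {a. (\<forall>m. a m \<in> val_ring v) \<and> ((\<lambda>m. v (a m)) \<longlongrightarrow> \<infinity>) at_bot}"

definition lmult :: "('k::field \<Rightarrow> ereal) \<Rightarrow> (int \<Rightarrow> 'k) \<Rightarrow> (int \<Rightarrow> 'k) \<Rightarrow> int \<Rightarrow> 'k" where
  "lmult v a b m = val_lim v (\<lambda>N. \<Sum>i\<in>{- int N..int N}. a i * b (m - i))"

definition lhat_ring :: "('k::field \<Rightarrow> ereal) \<Rightarrow> (int \<Rightarrow> 'k) ring" where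
  "lhat_ring v =
     \<lparr>carrier = lhat v, monoid.mult = lmult v, one = (\<lambda>m. if m = 0 then 1 else 0),
      ring.zero = (\<lambda>m. 0), add = (\<lambda>a b m. a m + b m)\<rparr>"

definition pow_ser :: "('k::field \<Rightarrow> ereal) \<Rightarrow> (int \<Rightarrow> 'k) set" where
  "pow_ser v = {a. (\<forall>m. a m \<in> val_ring v) \<and> (\<forall>m<0. a m = 0)}"

definition R_ab :: "('k::field \<Rightarrow> ereal) \<Rightarrow> real \<Rightarrow> real \<Rightarrow> (int \<Rightarrow> 'k) set" where
  "R_ab v \<alpha> \<beta> = {a. \<forall>m. a m \<in> val_ring v \<and> ereal (- \<alpha> * real_of_int m + \<beta>) \<le> v (a m)}"

text \<open>The set \<open>c M\<close> for a constant \<open>c\<close>, the set \<open>t\<^sup>-\<^sup>d M\<close>, and the set \<open>B + M\<close> for a set \<open>B\<close> of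
  constants.\<close>

definition scale_by :: "'k::field \<Rightarrow> (int \<Rightarrow> 'k) set \<Rightarrow> (int \<Rightarrow> 'k) set" where
  "scale_by c M = (\<lambda>a m. c * a m) ` M"

definition t_shift :: "int \<Rightarrow> (int \<Rightarrow> 'k) set \<Rightarrow> (int \<Rightarrow> 'k) set" where
  "t_shift d M = (\<lambda>a m. a (m + d)) ` M"

definition const_plus :: "'k::field set \<Rightarrow> (int \<Rightarrow> 'k) set \<Rightarrow> (int \<Rightarrow> 'k) set" where
  "const_plus B M = {\<lambda>m. (if m = 0 then r else 0) + a m | r a. r \<in> B \<and> a \<in> M}"

text \<open>\<open>a\<close> is the image of \<open>g\<close> in the \<open>(t)\<close>-adic completion \<open>R[[t]]\<close> of the local ring \<open>q\<close>.\<close>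

definition is_expansion ::
    "('k::field \<Rightarrow> ereal) \<Rightarrow> ('k \<Rightarrow> 'f::field) \<Rightarrow> 'f set \<Rightarrow> 'f \<Rightarrow> 'f \<Rightarrow> (int \<Rightarrow> 'k) \<Rightarrow> bool" where
  "is_expansion v \<iota> q t g a \<longleftrightarrow>
     a \<in> pow_ser v \<and>
     (\<forall>M::nat. g - (\<Sum>m<M. \<iota> (a (int m)) * t ^ m) \<in> (\<lambda>y. t ^ M * y) ` q)"

text \<open>The ideal of the special fibre in the local ring \<open>q\<close> is generated by \<open>\<pi>\<close>, so that \<open>h\<close>
  restricts to \<open>0\<close> on the special fibre iff it is a multiple of \<open>\<pi>\<close>.\<close>

definition xi ::
    "('k::field \<Rightarrow> ereal) \<Rightarrow> 'k \<Rightarrow> ('k \<Rightarrow> 'f::field) \<Rightarrow> 'f set \<Rightarrow> 'f \<Rightarrow> 'f \<Rightarrow> (int \<Rightarrow> 'k)" where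
  "xi v \<pi> \<iota> q t a =
     (THE z. \<exists>h u w. h \<in> q \<and> h \<notin> (\<lambda>y. \<iota> \<pi> * y) ` q \<and> h * a \<in> q \<and>
        is_expansion v \<iota> q t h u \<and> is_expansion v \<iota> q t (h * a) w \<and>
        z = inv\<^bsub>lhat_ring v\<^esub> u \<otimes>\<^bsub>lhat_ring v\<^esub> w)"


section \<open>The systems \<open>G\<close> and \<open>H\<close>\<close>

definition psi :: "('k::comm_ring_1 \<Rightarrow> 'k) \<Rightarrow> nat \<Rightarrow> 'k mpoly \<Rightarrow> 'k mpoly" where
  "psi \<sigma> p' = meval (\<lambda>c. mconst (\<sigma> c)) (\<lambda>i. mvar i ^ p')"

text \<open>All data are polynomials, hence so are the coefficients of \<open>G\<close>, and \<open>psi\<close> and the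
  expansion map on convergent power series are only needed on polynomials. \<open>G\<close> is a polynomial in
  \<open>S\<^sub>2, \<dots>, S\<^sub>n\<close> (outer variables) over \<open>R[x\<^sub>1, \<dots>, x\<^sub>n]\<close> (inner variables). The matrices \<open>P\<close> and
  \<open>\<Delta> j\<close> have column indices \<open>2, \<dots>, n\<close>, and \<open>P\<close> has row indices \<open>1, \<dots>, n\<close>.\<close>

definition G_system ::
    "('k::field \<Rightarrow> 'k) \<Rightarrow> nat \<Rightarrow> nat \<Rightarrow> (nat \<Rightarrow> 'k mpoly) \<Rightarrow> (nat \<Rightarrow> nat \<Rightarrow> 'k mpoly) \<Rightarrow>
     (nat \<Rightarrow> nat \<Rightarrow> nat \<Rightarrow> 'k mpoly) \<Rightarrow> nat \<Rightarrow> 'k mpoly mpoly" where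
  "G_system \<sigma> p' n f P \<Delta> i =
     meval (\<lambda>c. mconst (mconst c))
       (\<lambda>k. mconst (psi \<sigma> p' (mvar k)) + (\<Sum>l\<in>{2..n}. mconst (psi \<sigma> p' (P k l)) * mvar l))
       (Poly_Mapping.map \<sigma> (f i))
     - mconst (f i ^ p')
     - (\<Sum>j\<in>{2..n}. \<Sum>l\<in>{2..n}. mconst (f j ^ p' * psi \<sigma> p' (\<Delta> j i l)) * mvar l)"

text \<open>\<open>H\<^sub>i\<close> is represented by the function sending an exponent vector to the coefficient of the
  corresponding monomial in \<open>S\<^sub>2, \<dots>, S\<^sub>n\<close>. The expansion map on a polynomial in \<open>x\<^sub>1, \<dots>, x\<^sub>n\<close>
  factors through its value in the function field.\<close>

definition H_system ::
    "('k::field \<Rightarrow> ereal) \<Rightarrow> 'k \<Rightarrow> ('k \<Rightarrow> 'k) \<Rightarrow> nat \<Rightarrow> ('k \<Rightarrow> 'f::field) \<Rightarrow> nat \<Rightarrow> (nat \<Rightarrow> 'f) \<Rightarrow>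
     (nat \<Rightarrow> 'k mpoly) \<Rightarrow> (nat \<Rightarrow> nat \<Rightarrow> 'k mpoly) \<Rightarrow> (nat \<Rightarrow> nat \<Rightarrow> nat \<Rightarrow> 'k mpoly) \<Rightarrow>
     'f set \<Rightarrow> 'f \<Rightarrow> nat \<Rightarrow> (nat \<Rightarrow>\<^sub>0 nat) \<Rightarrow> int \<Rightarrow> 'k" where
  "H_system v \<pi> \<sigma> p' \<iota> n x f P \<Delta> q t i u =
     (if u \<in> Poly_Mapping.keys (G_system \<sigma> p' n f P \<Delta> i)
      then xi v \<pi> \<iota> q t (meval \<iota> x (Poly_Mapping.lookup (G_system \<sigma> p' n f P \<Delta> i) u))
      else \<zero>\<^bsub>lhat_ring v\<^esub>)"

definition sys_eval ::
    "('k::field \<Rightarrow> ereal) \<Rightarrow> ((nat \<Rightarrow>\<^sub>0 nat) \<Rightarrow> int \<Rightarrow> 'k) \<Rightarrow> (nat \<Rightarrow> int \<Rightarrow> 'k) \<Rightarrow> int \<Rightarrow> 'k" where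
  "sys_eval v h s =
     (\<Oplus>\<^bsub>lhat_ring v\<^esub>u\<in>{u. h u \<noteq> \<zero>\<^bsub>lhat_ring v\<^esub>}.
        h u \<otimes>\<^bsub>lhat_ring v\<^esub> (\<Otimes>\<^bsub>lhat_ring v\<^esub>j\<in>Poly_Mapping.keys u. s j [^]\<^bsub>lhat_ring v\<^esub> Poly_Mapping.lookup u j))"

definition sys_degree ::
    "('k::field \<Rightarrow> ereal) \<Rightarrow> nat \<Rightarrow> (nat \<Rightarrow> (nat \<Rightarrow>\<^sub>0 nat) \<Rightarrow> int \<Rightarrow> 'k) \<Rightarrow> nat" where
  "sys_degree v n H =
     Max (insert 0 {total_deg u | i u. i \<in> {2..n} \<and> H i u \<noteq> \<zero>\<^bsub>lhat_ring v\<^esub>})"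

text \<open>The derivative of \<open>H\<^sub>i\<close> with respect to \<open>S\<^sub>j\<close> at \<open>0\<close> is the coefficient of \<open>S\<^sub>j\<close> in \<open>H\<^sub>i\<close>.\<close>

definition jac_det ::
    "('k::field \<Rightarrow> ereal) \<Rightarrow> nat \<Rightarrow> (nat \<Rightarrow> (nat \<Rightarrow>\<^sub>0 nat) \<Rightarrow> int \<Rightarrow> 'k) \<Rightarrow> int \<Rightarrow> 'k" where
  "jac_det v n H = rdet (lhat_ring v) {2..n} (\<lambda>i j. H i (Poly_Mapping.single j 1))"

text \<open>The common shape of the two sets of hypotheses on the coefficients of \<open>H\<close>: the sets \<open>B l\<close>
  are \<open>t\<^sup>-\<^sup>d R[[t]]\<close> in one case and \<open>R_ab v \<alpha> (-d\<alpha>)\<close> in the other, with \<open>d = d l\<close>.\<close>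

definition coeff_bounds ::
    "('k::field \<Rightarrow> ereal) \<Rightarrow> 'k \<Rightarrow> nat \<Rightarrow> nat \<Rightarrow> (nat \<Rightarrow> (nat \<Rightarrow>\<^sub>0 nat) \<Rightarrow> int \<Rightarrow> 'k) \<Rightarrow>
     nat \<Rightarrow> nat \<Rightarrow> (nat \<Rightarrow> (int \<Rightarrow> 'k) set) \<Rightarrow> bool" where
  "coeff_bounds v \<pi> n N H a b B \<longleftrightarrow>
     (\<forall>i\<in>{2..n}. \<forall>u. Poly_Mapping.keys u \<subseteq> {2..n} \<longrightarrow>
        (total_deg u = 0 \<longrightarrow> H i u \<in> scale_by (\<pi> ^ a) (B 0)) \<and>
        (total_deg u = 1 \<longrightarrow> H i u \<in> const_plus (val_ring v) (scale_by (\<pi> ^ b) (B 1))) \<and>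
        (\<forall>l\<in>{2..N}. total_deg u = l \<longrightarrow> H i u \<in> B l)) \<and>
     jac_det v n H \<in> const_plus {r. v r = 0} (scale_by (\<pi> ^ b) (B 1))"

definition min_plus :: "ereal set \<Rightarrow> ereal" where
  "min_plus T =
     (let T' = {y \<in> T. 0 < y \<and> y < \<infinity>} in if T' = {} then \<infinity> else Min T')"

definition frac_entry :: "rat \<Rightarrow> int \<Rightarrow> ereal" where
  "frac_entry y d = (if d = 0 then \<infinity> else ereal (real_of_rat (y / of_int d)))"

definition alpha_nu :: "nat \<Rightarrow> nat \<Rightarrow> nat \<Rightarrow> nat \<Rightarrow> (nat \<Rightarrow> int) \<Rightarrow> rat \<Rightarrow> ereal" where
  "alpha_nu e N a b d \<nu> =
     ereal (1 / real e) *
     min_plus ({frac_entry (of_nat b) (d 1), frac_entry (of_nat a - \<nu>) (d 0)} \<union>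
               {frac_entry (of_nat (l - 1) * \<nu>) (d l) | l. l \<in> {2..N}})"


section \<open>The setting\<close>

text \<open>The complement of \<open>X\<close> in \<open>C\<close> becomes a union of sections over a finite extension of the
  base because it has pure codimension one and does not contain the special fibre; the section
  \<open>(q, ev)\<close> belongs to this complement.\<close>

locale curve_setting =
  fixes p e p' :: nat
    and v :: "'k::field_char_0 \<Rightarrow> ereal"
    and \<pi> :: 'k
    and red :: "'k \<Rightarrow> 'r::field"
    and \<sigma> :: "'k \<Rightarrow> 'k"
    and \<iota> :: "'k \<Rightarrow> 'f::field"
    and C :: "'f set set"
    and n :: nat
    and x :: "nat \<Rightarrow> 'f"
    and f :: "nat \<Rightarrow> 'k mpoly"
    and P :: "nat \<Rightarrow> nat \<Rightarrow> 'k mpoly"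
    and \<Delta> :: "nat \<Rightarrow> nat \<Rightarrow> nat \<Rightarrow> 'k mpoly"
    and q :: "'f set"
    and ev :: "'f \<Rightarrow> 'k"
    and t :: 'f
  assumes base_field: "padic_Galois_field p v"
    and uniformizer: "is_uniformizer v \<pi>"
    and ramification: "v (\<pi> ^ e) = v (of_nat p)"
    and residue_field: "is_residue_map v \<pi> red"
    and p'_power: "\<exists>r\<ge>1. p' = p ^ r"
    and sigma_aut: "\<sigma> \<in> ring_iso whole_ring whole_ring"
    and sigma_frobenius:
      "\<And>y. y \<in> val_ring v \<Longrightarrow> \<sigma> y \<in> val_ring v \<and> red (\<sigma> y) = red y ^ p'"
    and structure_map: "\<iota> \<in> ring_hom whole_ring whole_ring"
    and curve_proper: "proper_model v \<iota> C"
    and curve_smooth: "smooth_curve v \<iota> C"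
    and curve_fibres: "geometrically_irreducible_fibres v red \<iota> C"
    and n_pos: "1 \<le> n"
    and X_open: "affine_open v \<iota> C n x"
    and X_generic:
      "\<exists>\<eta> \<in> spec (subalgebra v \<iota> n x). zariski C closure_of {\<eta>} = special_fibre \<iota> \<pi> C"
    and X_presented: "presented_by v \<iota> n x f"
    and X_minors: "minors_generate_unit_ideal UNIV n (\<lambda>j. Poly_Mapping.map red (f j))"
    and P_coeffs: "\<And>i j. i \<in> {1..n} \<Longrightarrow> j \<in> {2..n} \<Longrightarrow> P i j \<in> polys (val_ring v) {1..n}"
    and Delta_coeffs:
      "\<And>j i l. j \<in> {2..n} \<Longrightarrow> i \<in> {2..n} \<Longrightarrow> l \<in> {2..n} \<Longrightarrow> \<Delta> j i l \<in> polys (val_ring v) {1..n}"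
    and Jac_P_Delta:
      "\<And>i l. i \<in> {2..n} \<Longrightarrow> l \<in> {2..n} \<Longrightarrow>
         (\<Sum>k\<in>{1..n}. mpderiv k (f i) * P k l)
           - ((if i = l then 1 else 0) + (\<Sum>j\<in>{2..n}. f j * \<Delta> j i l))
         \<in> (\<lambda>g. mconst \<pi> * g) ` polys (val_ring v) {1..n}"
    and section_Q: "is_section v \<iota> C q ev"
    and section_outside_X: "section_image q ev \<inter> spec (subalgebra v \<iota> n x) = {}"
    and local_equation: "t \<in> q" "section_kernel q ev = (\<lambda>y. t * y) ` q"

end

(* The linear part of H = 0 is solved for the coordinates s_k by Cramer's rule: if the determinant
   of the Jacobian matrix at 0 is r + y with r a unit constant, then r s_k equals the determinant
   with the k-th column replaced by minus the constant and higher-degree terms of H(s), minus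
   y s_k. Every higher-degree term contains at least two coordinates of s, and both s and y are
   divisible by pi. Hence, if s satisfies the asserted bound modulo pi^J, that is
   v(s_m) >= min(J/e, nu/e - alpha m), then it does so modulo pi^(J+1), and J tends to infinity. The
   choice of alpha is exactly what makes the terms of H preserve the bound nu/e - alpha m.
   The products of series converge because a finite extension of a complete field is complete;
   their ring laws are inherited modulo every power of pi from ordinary Laurent series. *)
theory Submission
  imports Defs "HOL-Computational_Algebra.Formal_Laurent_Series"
begin

section \<open>Complete valued fields\<close>

text \<open>Read \<open>v (a m) \<ge> \<beta> - \<alpha> m\<close> as a line of slope -\<alpha> with
  intercept \<beta>, and give every variable S_j the intercept \<kappa> = \<nu>/e. A monomial of
  degree l in the coordinates then has intercept l \<kappa>, so to land on \<kappa> again its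
  coefficient must have intercept at least (1 - l) \<kappa>. The factor t^(-d_l) has intercept
  -\<alpha> d_l, whence the condition \<alpha> d_l \<le> (l - 1) \<nu>/e. For l = 0 the factor pi^a
  adds a/e, which gives \<alpha> d_0 \<le> (a - \<nu>)/e. For l = 1 only the part divisible by pi^b
  has to be kept at intercept 0, which gives \<alpha> d_1 \<le> b/e. These are the entries of the
  minimum; for d_l \<le> 0 each of them holds by itself, so such entries can be ignored. The
  solution is given and not constructed: every step of the induction feeds the same s into the same
  equations, and only the precision to which its bound is known grows. It grows because an error of
  one factor is always multiplied by another factor divisible by pi.\<close>

locale valued_field =
  fixes v :: "'k::field \<Rightarrow> ereal"
  assumes valuation: "is_valuation v"
begin

lemma v_eq_infty [simp]: "v x = \<infinity> \<longleftrightarrow> x = 0"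
  and v_not_minfty [simp]: "v x \<noteq> -\<infinity>"
  and v_mult: "v (x * y) = v x + v y"
  and v_add: "min (v x) (v y) \<le> v (x + y)"
  using valuation by (auto simp: is_valuation_def)

lemma v_zero [simp]: "v 0 = \<infinity>"
  by simp

lemma v_real: assumes "x \<noteq> 0" obtains r where "v x = ereal r"
  using assms by (cases "v x") auto

lemma v_one [simp]: "v 1 = 0"
proof -
  obtain r where r: "v 1 = ereal r" using v_real[of 1] by auto
  have "v (1 * 1) = v 1 + v 1" by (rule v_mult)
  with r show ?thesis by simp
qed

lemma v_minus [simp]: "v (- x) = v x"
proof -
  obtain r where r: "v (- 1) = ereal r" using v_real[of "- 1"] by auto
  have "v ((- 1) * (- 1)) = v (- 1) + v (- 1)" by (rule v_mult)
  hence "v (- 1) = 0" using r by simp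
  with v_mult[of "- 1" x] show ?thesis by simp
qed

lemma v_minus_commute: "v (x - y) = v (y - x)"
  using v_minus[of "x - y"] by simp

lemma v_add_ge: "c \<le> v x \<Longrightarrow> c \<le> v y \<Longrightarrow> c \<le> v (x + y)"
  using v_add[of x y] by (meson min.boundedI order_trans)

lemma v_diff_ge: "c \<le> v x \<Longrightarrow> c \<le> v y \<Longrightarrow> c \<le> v (x - y)"
  using v_add_ge[of c x "- y"] by simp

lemma v_sum_ge: "(\<And>i. i \<in> A \<Longrightarrow> c \<le> v (g i)) \<Longrightarrow> c \<le> v (sum g A)"
  by (induction A rule: infinite_finite_induct) (auto intro: v_add_ge)

lemma v_mult_ge: "c \<le> v x \<Longrightarrow> d \<le> v y \<Longrightarrow> c + d \<le> v (x * y)"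
  by (simp add: v_mult add_mono)

lemma v_power: "v x = ereal r \<Longrightarrow> v (x ^ n) = ereal (real n * r)"
  by (induction n) (simp_all add: v_mult ring_distribs flip: zero_ereal_def)

lemma val_tendsto_iff:
  "val_tendsto v z l \<longleftrightarrow> (\<forall>c::real. \<exists>N. \<forall>n\<ge>N. ereal c \<le> v (z n - l))"
proof
  assume "val_tendsto v z l"
  then show "\<forall>c::real. \<exists>N. \<forall>n\<ge>N. ereal c \<le> v (z n - l)"
    unfolding val_tendsto_def tendsto_PInfty eventually_sequentially by (meson less_imp_le)
next
  assume *: "\<forall>c::real. \<exists>N. \<forall>n\<ge>N. ereal c \<le> v (z n - l)"
  show "val_tendsto v z l"
    unfolding val_tendsto_def tendsto_PInfty eventually_sequentially
  proof
    fix r :: real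
    obtain N where "\<forall>n\<ge>N. ereal (r + 1) \<le> v (z n - l)" using * by blast
    moreover have "ereal r < ereal (r + 1)" by simp
    ultimately show "\<exists>N. \<forall>n\<ge>N. ereal r < v (z n - l)" by (meson less_le_trans)
  qed
qed

lemma val_tendsto_ge:
  assumes "val_tendsto v z l" "\<And>n. c \<le> v (z n)" shows "c \<le> v l"
proof (rule ereal_le_real)
  fix r :: real assume "v l \<le> ereal r"
  then have neq: "l \<noteq> 0" by auto
  obtain s where s: "v l = ereal s" using v_real[OF neq] .
  \<comment> \<open>Precision \<open>s + 1\<close> exceeds \<open>v l = s\<close>. In the
    ultrametric estimate below, the error term can therefore not be the part of the minimum that is
    at most \<open>s\<close>, which leaves \<open>c\<close>.\<close>
  obtain n where n: "ereal (s + 1) \<le> v (z n - l)"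
    using assms(1) unfolding val_tendsto_iff by blast
  have "min c (ereal (s + 1)) \<le> v (z n - (z n - l))"
    by (rule v_diff_ge[OF min.coboundedI1[OF assms(2)] min.coboundedI2[OF n]])
  also have "\<dots> = ereal s" by (simp add: s)
  finally have "c \<le> ereal s" by (auto simp: min_le_iff_disj)
  then show "c \<le> ereal r" using s \<open>v l \<le> ereal r\<close> by (metis order_trans)
qed

lemma v_ge_all_zero: assumes "\<And>c::real. ereal c \<le> v x" shows "x = 0"
proof (rule ccontr)
  assume "x \<noteq> 0"
  then obtain s where "v x = ereal s" by (rule v_real)
  with assms[of "s + 1"] show False by simp
qed

lemma val_tendsto_unique:
  assumes "val_tendsto v z l" "val_tendsto v z l'" shows "l = l'"
proof -
  have "ereal c \<le> v (l - l')" for c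
  proof -
    obtain N where N: "\<forall>n\<ge>N. ereal c \<le> v (z n - l)"
      using assms(1) unfolding val_tendsto_iff by blast
    obtain N' where N': "\<forall>n\<ge>N'. ereal c \<le> v (z n - l')"
      using assms(2) unfolding val_tendsto_iff by blast
    have "ereal c \<le> v ((z (max N N') - l') - (z (max N N') - l))"
      by (rule v_diff_ge) (use N N' in \<open>meson max.cobounded1 max.cobounded2\<close>)+
    then show ?thesis by simp
  qed
  then show ?thesis using v_ge_all_zero[of "l - l'"] by simp
qed

lemma val_lim_eqI: "val_tendsto v z l \<Longrightarrow> val_lim v z = l"
  unfolding val_lim_def using val_tendsto_unique by blast

lemma val_tendsto_add:
  assumes "val_tendsto v z l" "val_tendsto v z' l'"
  shows "val_tendsto v (\<lambda>n. z n + z' n) (l + l')"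
  unfolding val_tendsto_iff
proof
  fix c :: real
  obtain N where N: "\<forall>n\<ge>N. ereal c \<le> v (z n - l)"
    using assms(1) unfolding val_tendsto_iff by blast
  obtain N' where N': "\<forall>n\<ge>N'. ereal c \<le> v (z' n - l')"
    using assms(2) unfolding val_tendsto_iff by blast
  have "ereal c \<le> v ((z n - l) + (z' n - l'))" if "n \<ge> max N N'" for n
    using N N' that by (intro v_add_ge) auto
  then show "\<exists>N. \<forall>n\<ge>N. ereal c \<le> v (z n + z' n - (l + l'))"
    by (metis (no_types, opaque_lifting) add_diff_add)
qed

lemma val_tendsto_cmult:
  assumes "val_tendsto v z l"
  shows "val_tendsto v (\<lambda>n. z n * a) (l * a)"
proof (cases "a = 0")
  case False
  then obtain s where s: "v a = ereal s" by (rule v_real)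
  show ?thesis unfolding val_tendsto_iff
  proof
    fix c :: real
    obtain N where N: "\<forall>n\<ge>N. ereal (c - s) \<le> v (z n - l)"
      using assms unfolding val_tendsto_iff by blast
    have "ereal c \<le> v ((z n - l) * a)" if "n \<ge> N" for n
      using v_mult_ge[of "ereal (c - s)" "z n - l" "ereal s" a] N that s by simp
    then show "\<exists>N. \<forall>n\<ge>N. ereal c \<le> v (z n * a - l * a)"
      by (auto simp: left_diff_distrib)
  qed
qed (simp add: val_tendsto_iff)

section \<open>Completeness of finite extensions\<close>

definition complete_on :: "'k set \<Rightarrow> bool" where
  "complete_on E \<longleftrightarrow> (\<forall>z. (\<forall>n. z n \<in> E) \<and> val_Cauchy v z \<longrightarrow> (\<exists>x\<in>E. val_tendsto v z x))"

text \<open>Otherwise points of \<open>E\<close> come arbitrarily close to \<open>a\<close>; they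
  form a Cauchy sequence, whose limit in \<open>E\<close> would have to be \<open>a\<close>. The
  constant \<open>c\<close> takes the place of a comparison of norms in the next lemma.\<close>

lemma complete_on_distance:
  assumes E: "complete_on E" and a: "a \<notin> E"
  obtains c :: real where "\<And>w. w \<in> E \<Longrightarrow> v (a - w) \<le> ereal c"
proof (rule ccontr)
  assume "\<not> thesis"
  with that have "\<forall>c::real. \<exists>w\<in>E. ereal c < v (a - w)" by (meson not_le)
  then have "\<forall>n::nat. \<exists>w. w \<in> E \<and> ereal (real n) < v (a - w)" by blast
  then obtain w where w: "\<And>n::nat. w n \<in> E" "\<And>n. ereal (real n) < v (a - w n)" by metis
  have lim: "val_tendsto v w a" unfolding val_tendsto_iff
  proof
    fix c :: real
    obtain N :: nat where N: "c \<le> N" using real_arch_simple by blast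
    have "ereal c \<le> v (w n - a)" if "n \<ge> N" for n
    proof -
      have "ereal c \<le> ereal (real n)" using N that by simp
      also have "\<dots> \<le> v (w n - a)" using w(2)[of n] by (simp add: v_minus_commute)
      finally show ?thesis .
    qed
    then show "\<exists>N. \<forall>n\<ge>N. ereal c \<le> v (w n - a)" by blast
  qed
  have "val_Cauchy v w" unfolding val_Cauchy_def
  proof
    fix c :: real
    obtain N where N: "\<forall>n\<ge>N. ereal c \<le> v (w n - a)"
      using lim unfolding val_tendsto_iff by blast
    have "ereal c \<le> v ((w m - a) - (w n - a))" if "m \<ge> N" "n \<ge> N" for m n
      by (rule v_diff_ge) (use N that in blast)+
    then show "\<exists>N. \<forall>m\<ge>N. \<forall>n\<ge>N. ereal c \<le> v (w m - w n)" by auto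
  qed
  with E w(1) obtain a' where "a' \<in> E" "val_tendsto v w a'" unfolding complete_on_def by blast
  with lim val_tendsto_unique a show False by blast
qed

text \<open>By the distance bound the coefficient of \<open>a\<close> is controlled by the whole
  vector. A Cauchy sequence in the span therefore has Cauchy coordinates in \<open>L\<close> and
  \<open>E\<close>, and these converge separately.\<close>

lemma complete_on_line_extension:
  assumes L: "complete_on L" and E: "complete_on E" and a: "a \<notin> E"
    and L_diff: "\<And>x y. x \<in> L \<Longrightarrow> y \<in> L \<Longrightarrow> x - y \<in> L"
    and L_inv: "\<And>x. x \<in> L \<Longrightarrow> x \<noteq> 0 \<Longrightarrow> inverse x \<in> L"
    and E_zero: "0 \<in> E"
    and E_diff: "\<And>x y. x \<in> E \<Longrightarrow> y \<in> E \<Longrightarrow> x - y \<in> E"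
    and E_scale: "\<And>k x. k \<in> L \<Longrightarrow> x \<in> E \<Longrightarrow> k * x \<in> E"
  shows "complete_on {k * a + w | k w. k \<in> L \<and> w \<in> E}"
  unfolding complete_on_def
proof safe
  fix z assume z: "\<forall>n. z n \<in> {k * a + w | k w. k \<in> L \<and> w \<in> E}" and Cz: "val_Cauchy v z"
  from z have "\<forall>n. \<exists>k w. k \<in> L \<and> w \<in> E \<and> z n = k * a + w" by blast
  then obtain k w where kw: "\<And>n. k n \<in> L" "\<And>n. w n \<in> E" "\<And>n. z n = k n * a + w n"
    by metis
  obtain c where c: "\<And>w. w \<in> E \<Longrightarrow> v (a - w) \<le> ereal c"
    using complete_on_distance[OF E a] by blast
  \<comment> \<open>Division by \<open>y\<close> turns the vector into a difference of
    \<open>a\<close> and a point of \<open>E\<close>, to which \<open>c\<close> applies; multiplying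
    back shifts the bound by \<open>v y\<close>.\<close>
  have lower: "v (y * a + w) \<le> v y + ereal c" if y: "y \<in> L" and w: "w \<in> E" for y w
  proof (cases "y = 0")
    case False
    have "inverse y * (0 - w) \<in> E" using y w False by (intro E_scale E_diff L_inv E_zero)
    then have "v y + v (a - inverse y * (0 - w)) \<le> v y + ereal c" by (intro add_mono c order_refl)
    also have "v y + v (a - inverse y * (0 - w)) = v (y * (a - inverse y * (0 - w)))"
      by (simp add: v_mult)
    also have "y * (a - inverse y * (0 - w)) = y * a + w" using False by (simp add: field_simps)
    finally show ?thesis .
  qed simp
  have "a \<noteq> 0" using a E_zero by auto
  then obtain s where s: "v a = ereal s" by (rule v_real)
  have k_diff: "ereal (r - c) \<le> v (k m - k n)" if "ereal r \<le> v (z m - z n)" for m n r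
  proof -
    have "ereal r \<le> v ((k m - k n) * a + (w m - w n))"
      using that by (simp add: kw(3) algebra_simps)
    also have "\<dots> \<le> v (k m - k n) + ereal c" by (intro lower L_diff E_diff kw)
    finally show ?thesis by (cases "v (k m - k n)") auto
  qed
  have "val_Cauchy v k" unfolding val_Cauchy_def
  proof
    fix r :: real
    obtain N where N: "\<forall>m\<ge>N. \<forall>n\<ge>N. ereal (r + c) \<le> v (z m - z n)"
      using Cz unfolding val_Cauchy_def by blast
    then show "\<exists>N. \<forall>m\<ge>N. \<forall>n\<ge>N. ereal r \<le> v (k m - k n)"
      using k_diff[of "r + c"] by (metis add_diff_cancel_right')
  qed
  then obtain k0 where k0: "k0 \<in> L" "val_tendsto v k k0"
    using L kw(1) unfolding complete_on_def by blast
  have "val_Cauchy v w" unfolding val_Cauchy_def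
  proof
    fix r :: real
    \<comment> \<open>Passing from \<open>z\<close> to \<open>k\<close> costs \<open>c\<close>, and
      multiplication by \<open>a\<close> gives back \<open>s\<close>. So \<open>r'\<close> is the
      least precision with both \<open>r' \<ge> r\<close> and
      \<open>r' - c + s \<ge> r\<close>.\<close>
    define r' where "r' = max r (r - s + c)"
    obtain N where N: "\<forall>m\<ge>N. \<forall>n\<ge>N. ereal r' \<le> v (z m - z n)"
      using Cz unfolding val_Cauchy_def by blast
    have "ereal r \<le> v ((z m - z n) - (k m - k n) * a)" if "m \<ge> N" "n \<ge> N" for m n
    proof (rule v_diff_ge)
      have z: "ereal r' \<le> v (z m - z n)" using N that by blast
      moreover have "ereal r \<le> ereal r'" by (simp add: r'_def)
      ultimately show "ereal r \<le> v (z m - z n)" by (rule order_trans[rotated])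
      have "ereal r \<le> ereal (r' - c) + ereal s" by (simp add: r'_def max_def)
      also have "\<dots> \<le> v ((k m - k n) * a)" using k_diff[OF z] s by (intro v_mult_ge) auto
      finally show "ereal r \<le> v ((k m - k n) * a)" .
    qed
    then show "\<exists>N. \<forall>m\<ge>N. \<forall>n\<ge>N. ereal r \<le> v (w m - w n)"
      by (auto simp: kw(3) algebra_simps)
  qed
  then obtain w0 where w0: "w0 \<in> E" "val_tendsto v w w0"
    using E kw(2) unfolding complete_on_def by blast
  have "z = (\<lambda>n. k n * a + w n)" using kw(3) by blast
  then have "val_tendsto v z (k0 * a + w0)"
    using val_tendsto_add[OF val_tendsto_cmult[OF k0(2)] w0(2)] by simp
  then show "\<exists>x\<in>{k * a + w | k w. k \<in> L \<and> w \<in> E}. val_tendsto v z x" using k0(1) w0(1) by blast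
qed

end

lemma whole_ring_simps [simp]:
  "carrier (whole_ring :: 'a::ring_1 ring) = UNIV"
  "x \<oplus>\<^bsub>(whole_ring :: 'a::ring_1 ring)\<^esub> y = x + y"
  "x \<otimes>\<^bsub>(whole_ring :: 'a::ring_1 ring)\<^esub> y = x * y"
  "\<zero>\<^bsub>(whole_ring :: 'a::ring_1 ring)\<^esub> = 0"
  "\<one>\<^bsub>(whole_ring :: 'a::ring_1 ring)\<^esub> = 1"
  by (simp_all add: ring_of_type_algebra_def)

lemma whole_ring_a_inv [simp]: "\<ominus>\<^bsub>(whole_ring :: 'a::comm_ring_1 ring)\<^esub> x = - x"
proof -
  interpret ring "whole_ring :: 'a ring" by (rule ring_from_type_algebra)
  show ?thesis by (rule minus_equality) auto
qed

lemma (in valued_field) complete_on_finite_dimension: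
  assumes subfield: "subfield L whole_ring" and L: "complete_on L"
    and dim: "ring.dimension whole_ring n L E"
  shows "complete_on E"
proof -
  interpret R: field "whole_ring :: 'k ring" by (rule field_from_type_algebra)
  interpret Lf: subfield L "whole_ring :: 'k ring" by (rule subfield)
  have L_diff: "x - y \<in> L" if "x \<in> L" "y \<in> L" for x y
  proof -
    have "- y \<in> L" using R.add.subgroupE(3)[OF Lf.is_subgroup, of y] that(2) by simp
    then have "x + - y \<in> L"
      using R.add.subgroupE(4)[OF Lf.is_subgroup, of x "- y"] that(1) by simp
    then show ?thesis by simp
  qed
  have L_inv: "inverse x \<in> L" if "x \<in> L" "x \<noteq> 0" for x
  proof -
    have "inv\<^bsub>whole_ring\<^esub> x \<in> L" using R.subfield_m_inv(1)[OF subfield, of x] that by simp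
    moreover have "inv\<^bsub>whole_ring\<^esub> x = inverse x"
      using that by (intro R.inv_unique'[symmetric]) auto
    ultimately show ?thesis by simp
  qed
  \<comment> \<open>The claim also carries the closure properties of \<open>E\<close>, which
    \<open>complete_on_line_extension\<close> requires of the smaller space. The equation
    \<open>K = L\<close> is there because the induction rule treats the base field as a
    variable.\<close>
  have "complete_on E \<and> 0 \<in> E \<and> (\<forall>x\<in>E. \<forall>y\<in>E. x - y \<in> E) \<and> (\<forall>k\<in>K. \<forall>x\<in>E. k * x \<in> E)"
    if "R.dimension n K E" "K = L" for n K E
    using that
  proof (induction rule: R.dimension.induct)
    case (zero_dim K)
    show ?case 
    proof (intro conjI)
      show "complete_on {\<zero>\<^bsub>whole_ring\<^esub>}"
        unfolding complete_on_def by (auto simp: val_tendsto_iff)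
    qed auto
  next
    case (Suc_dim a E n K)
    then have IH: "complete_on E" "0 \<in> E" "\<And>x y. x \<in> E \<Longrightarrow> y \<in> E \<Longrightarrow> x - y \<in> E"
      "\<And>k x. k \<in> L \<Longrightarrow> x \<in> E \<Longrightarrow> k * x \<in> E" by auto
    have 0: "0 \<in> L" using R.add.subgroupE(2)[OF Lf.is_subgroup] L_diff by (metis all_not_in_conv diff_self)
    have eq: "R.line_extension K a E = {k * a + w | k w. k \<in> L \<and> w \<in> E}"
      unfolding set_eq_iff R.line_extension_mem_iff using \<open>K = L\<close> by simp blast
    show ?case unfolding eq
    proof (intro conjI ballI)
      show "complete_on {k * a + w | k w. k \<in> L \<and> w \<in> E}"
        using L IH(1) Suc_dim.hyps(2) L_diff L_inv IH(2-4) by (rule complete_on_line_extension)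
      show "0 \<in> {k * a + w | k w. k \<in> L \<and> w \<in> E}"
        using 0 IH(2) by (intro CollectI exI[of _ 0]) simp
    next
      fix x y assume "x \<in> {k * a + w | k w. k \<in> L \<and> w \<in> E}" "y \<in> {k * a + w | k w. k \<in> L \<and> w \<in> E}"
      then obtain k w k' w' where *: "x = k * a + w" "y = k' * a + w'" "k \<in> L" "w \<in> E" "k' \<in> L" "w' \<in> E"
        by blast
      then have "x - y = (k - k') * a + (w - w')" by (simp add: algebra_simps)
      then show "x - y \<in> {k * a + w | k w. k \<in> L \<and> w \<in> E}"
        using L_diff[OF *(3,5)] IH(3)[OF *(4,6)] by blast
    next
      fix c x assume c: "c \<in> K" and "x \<in> {k * a + w | k w. k \<in> L \<and> w \<in> E}"
      then obtain k w where *: "x = k * a + w" "k \<in> L" "w \<in> E" by blast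
      then have "c * x = (c * k) * a + c * w" by (simp add: algebra_simps)
      moreover have "c * k \<in> L" using Lf.m_closed[of c k] c *(2) \<open>K = L\<close> by simp
      ultimately show "c * x \<in> {k * a + w | k w. k \<in> L \<and> w \<in> E}"
        using IH(4)[of c w] c *(3) \<open>K = L\<close> by blast
    qed
  qed
  from this[OF dim] show ?thesis by blast
qed

locale complete_valued_field = valued_field v for v :: "'k::field \<Rightarrow> ereal" +
  assumes complete: "complete_on UNIV"

lemma padic_Galois_field_complete:
  assumes "padic_Galois_field p v" shows "complete_valued_field v"
proof -
  from assms have val: "is_valuation v" by (simp add: padic_Galois_field_def)
  interpret valued_field v by standard (rule val)
  obtain L where L: "is_padic_numbers p v L" "finite_Galois_over L"
    using assms by (auto simp: padic_Galois_field_def)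
  have "ring.finite_dimension whole_ring L (UNIV :: 'a set)"
    using L(2) by (simp add: finite_Galois_over_def)
  then obtain n where n: "ring.dimension whole_ring n L (UNIV :: 'a set)"
    by (auto simp: ring.finite_dimension_def[OF ring_from_type_algebra])
  have "subfield L whole_ring" "complete_on L"
    using L(1) unfolding is_padic_numbers_def complete_on_def by blast+
  then have "complete_on UNIV" using n by (rule complete_on_finite_dimension)
  then show ?thesis by unfold_locales
qed

section \<open>The ring of Laurent series\<close>

context valued_field
begin

lemma mem_lhat_iff:
  "a \<in> lhat v \<longleftrightarrow> (\<forall>m. 0 \<le> v (a m)) \<and> (\<forall>c::real. \<exists>k. \<forall>m<k. ereal c \<le> v (a m))"
proof -
  have "((\<lambda>m. v (a m)) \<longlongrightarrow> \<infinity>) at_bot \<longleftrightarrow> (\<forall>c::real. \<exists>k. \<forall>m<k. ereal c \<le> v (a m))"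
    (is "?l \<longleftrightarrow> ?r")
  proof
    assume ?l
    then have "\<exists>k. \<forall>m\<le>k. ereal c < v (a m)" for c :: real
      unfolding tendsto_PInfty eventually_at_bot_linorder by blast
    then show ?r by (meson less_imp_le)
  next
    assume r: ?r
    show ?l unfolding tendsto_PInfty eventually_at_bot_linorder
    proof
      fix c :: real
      obtain k where k: "\<forall>m<k. ereal (c + 1) \<le> v (a m)" using r by blast
      have "ereal c < v (a m)" if "m \<le> k - 1" for m
      proof -
        have "ereal c < ereal (c + 1)" by simp
        also have "\<dots> \<le> v (a m)" using k that by simp
        finally show ?thesis .
      qed
      then show "\<exists>k. \<forall>m\<le>k. ereal c < v (a m)" by blast
    qed
  qed
  then show ?thesis by (simp add: lhat_def val_ring_def)
qed

lemma lhat_nonneg: "a \<in> lhat v \<Longrightarrow> 0 \<le> v (a m)"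
  by (simp add: mem_lhat_iff)

lemma lhat_add: assumes "a \<in> lhat v" "b \<in> lhat v" shows "(\<lambda>m. a m + b m) \<in> lhat v"
  unfolding mem_lhat_iff
proof safe
  show "0 \<le> v (a m + b m)" for m using assms by (intro v_add_ge lhat_nonneg)
  fix c :: real
  obtain k where k: "\<forall>m<k. ereal c \<le> v (a m)" using assms(1) unfolding mem_lhat_iff by blast
  obtain l where l: "\<forall>m<l. ereal c \<le> v (b m)" using assms(2) unfolding mem_lhat_iff by blast
  show "\<exists>k. \<forall>m<k. ereal c \<le> v (a m + b m)"
    using k l by (intro exI[of _ "min k l"]) (auto intro!: v_add_ge)
qed

lemma lhat_cmult: assumes "a \<in> lhat v" "0 \<le> v r" shows "(\<lambda>m. r * a m) \<in> lhat v"
proof -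
  have ge: "v (a m) \<le> v (r * a m)" for m
    using v_mult_ge[OF assms(2) order_refl, of "a m"] by simp
  show ?thesis using assms(1) unfolding mem_lhat_iff by (meson ge order_trans)
qed

lemma lhat_zero: "(\<lambda>m. 0) \<in> lhat v"
  by (auto simp: mem_lhat_iff)

lemma lhat_const: assumes "0 \<le> v r" shows "(\<lambda>m. if m = 0 then r else 0) \<in> lhat v"
  unfolding mem_lhat_iff
proof safe
  fix c :: real
  have "ereal c \<le> v (if m = 0 then r else 0)" if "m < 0" for m :: int using that by simp
  then show "\<exists>k. \<forall>m<k. ereal c \<le> v (if (m::int) = 0 then r else 0)" by blast
qed (use assms in auto)

text \<open>Both ends of the two-sided sum are small: for \<open>i\<close> near minus infinity
  because of \<open>a\<close>, and for \<open>i\<close> near plus infinity because the index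
  \<open>m - i\<close> of \<open>b\<close> tends to minus infinity. The other factor is integral and
  does no harm.\<close>

lemma lmult_tail:
  assumes a: "a \<in> lhat v" and b: "b \<in> lhat v"
  obtains N0 :: nat where "\<And>N i. N0 \<le> N \<Longrightarrow> i \<notin> {- int N..int N} \<Longrightarrow> ereal c \<le> v (a i * b (m - i))"
proof -
  obtain k where k: "\<forall>m<k. ereal c \<le> v (a m)" using a unfolding mem_lhat_iff by blast
  obtain l where l: "\<forall>m<l. ereal c \<le> v (b m)" using b unfolding mem_lhat_iff by blast
  have "ereal c \<le> v (a i * b (m - i))"
    if N: "nat (\<bar>k\<bar> + \<bar>l\<bar> + \<bar>m\<bar>) \<le> N" and i: "i \<notin> {- int N..int N}" for N i
  proof (cases "i < k")
    case True
    then have "ereal c + 0 \<le> v (a i * b (m - i))" using k b by (intro v_mult_ge lhat_nonneg) auto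
    then show ?thesis by simp
  next
    case False
    have "m - i < l" using N i False by auto
    then have "0 + ereal c \<le> v (a i * b (m - i))" using l a by (intro v_mult_ge lhat_nonneg) auto
    then show ?thesis by simp
  qed
  then show thesis by (rule that)
qed

end

context complete_valued_field
begin

text \<open>\<open>lmult\<close> is a definite description of a limit, so nothing can be read off
  from it before convergence is known. Two partial sums differ by terms of the tail, hence they are
  Cauchy.\<close>

lemma lmult_tendsto:
  assumes a: "a \<in> lhat v" and b: "b \<in> lhat v"
  shows "val_tendsto v (\<lambda>N. \<Sum>i\<in>{- int N..int N}. a i * b (m - i)) (lmult v a b m)"
    (is "val_tendsto v ?S _")
proof -
  have "val_Cauchy v ?S" unfolding val_Cauchy_def
  proof
    fix c :: real
    obtain N0 where N0:
      "\<And>N i. N0 \<le> N \<Longrightarrow> i \<notin> {- int N..int N} \<Longrightarrow> ereal c \<le> v (a i * b (m - i))"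
      using lmult_tail[OF a b] by blast
    have *: "ereal c \<le> v (?S N' - ?S N)" if "N0 \<le> N" "N \<le> N'" for N N'
    proof -
      have "?S N' - ?S N = (\<Sum>i\<in>{- int N'..int N'} - {- int N..int N}. a i * b (m - i))"
        using that by (subst sum_diff) auto
      also have "ereal c \<le> v \<dots>" using that by (intro v_sum_ge N0[of N]) auto
      finally show ?thesis .
    qed
    show "\<exists>N. \<forall>m\<ge>N. \<forall>n\<ge>N. ereal c \<le> v (?S m - ?S n)"
    proof (intro exI allI impI)
      fix N N' assume N: "N0 \<le> N" "N0 \<le> N'"
      show "ereal c \<le> v (?S N - ?S N')"
      proof (cases "N \<le> N'")
        case True
        have "ereal c \<le> v (?S N' - ?S N)" by (rule *[OF N(1) True])
        then show ?thesis by (subst v_minus_commute)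
      next
        case False
        then show ?thesis by (intro *[OF N(2)]) simp
      qed
    qed
  qed
  then obtain l where "val_tendsto v ?S l" using complete unfolding complete_on_def by blast
  then show ?thesis using val_lim_eqI by (simp add: lmult_def)
qed

lemma lmult_ge:
  assumes "a \<in> lhat v" "b \<in> lhat v" "\<And>i. c \<le> v (a i * b (m - i))"
  shows "c \<le> v (lmult v a b m)"
  using assms by (intro val_tendsto_ge[OF lmult_tendsto] v_sum_ge)

text \<open>Congruence of a two-sided series with an ordinary Laurent series modulo elements of
  valuation at least \<open>c\<close>. Integrality of \<open>A\<close> is included so that products
  keep the same precision \<open>c\<close>.\<close>

definition fls_approx :: "real \<Rightarrow> (int \<Rightarrow> 'k) \<Rightarrow> 'k fls \<Rightarrow> bool" where
  "fls_approx c a A \<longleftrightarrow> (\<forall>m. ereal c \<le> v (a m - fls_nth A m)) \<and> (\<forall>m. 0 \<le> v (fls_nth A m))"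

text \<open>All coefficients below some index have valuation at least \<open>c\<close>; deleting
  them leaves a Laurent series with finitely many negative powers.\<close>

lemma ex_fls_approx:
  assumes a: "a \<in> lhat v" obtains A where "fls_approx c a A"
proof -
  obtain k where k: "\<forall>m<k. ereal c \<le> v (a m)" using a unfolding mem_lhat_iff by blast
  have "fls_nth (Abs_fls (\<lambda>m. if m < k then 0 else a m)) m = (if m < k then 0 else a m)" for m
    by (rule nth_Abs_fls_lower_bound[of k]) simp
  then have "fls_approx c a (Abs_fls (\<lambda>m. if m < k then 0 else a m))"
    using k lhat_nonneg[OF a] by (simp add: fls_approx_def)
  then show thesis by (rule that)
qed

text \<open>The device for transferring ring laws: if both sides of an identity are approximated by
  one Laurent series at every precision, their difference has infinite valuation.\<close>

lemma fls_approx_eqI: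
  assumes "\<And>c. \<exists>A. fls_approx c a A \<and> fls_approx c b A" shows "a = b"
proof
  fix m
  have "ereal c \<le> v (a m - b m)" for c
  proof -
    obtain A where "fls_approx c a A" "fls_approx c b A" using assms by blast
    then have "ereal c \<le> v (a m - fls_nth A m)" "ereal c \<le> v (b m - fls_nth A m)"
      unfolding fls_approx_def by blast+
    then have "ereal c \<le> v ((a m - fls_nth A m) - (b m - fls_nth A m))" by (rule v_diff_ge)
    then show ?thesis by simp
  qed
  then show "a m = b m" using v_ge_all_zero[of "a m - b m"] by simp
qed

lemma fls_approx_add:
  assumes "fls_approx c a A" "fls_approx c b B"
  shows "fls_approx c (\<lambda>m. a m + b m) (A + B)"
  unfolding fls_approx_def
proof safe
  fix m
  have "ereal c \<le> v ((a m - fls_nth A m) + (b m - fls_nth B m))"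
    using assms unfolding fls_approx_def by (intro v_add_ge) blast+
  then show "ereal c \<le> v (a m + b m - fls_nth (A + B) m)" by (simp add: add_diff_add)
  show "0 \<le> v (fls_nth (A + B) m)"
    using assms unfolding fls_approx_def plus_fls.rep_eq by (intro v_add_ge) blast+
qed

lemma fls_approx_one: "fls_approx c (\<lambda>m. if m = 0 then 1 else 0) 1"
  by (simp add: fls_approx_def)

text \<open>Widening the range of summation to a large symmetric interval only adds zeros. In this
  form the coefficient can be compared with the partial sums that define
  \<open>lmult\<close>.\<close>

lemma fls_times_nth_symmetric:
  fixes A B :: "'a::comm_ring_1 fls"
  obtains N0 :: nat where
    "\<And>N. N0 \<le> N \<Longrightarrow> fls_nth (A * B) m = (\<Sum>i\<in>{- int N..int N}. fls_nth A i * fls_nth B (m - i))"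
proof -
  define dA where "dA = fls_subdegree A"
  define dB where "dB = fls_subdegree B"
  have "fls_nth (A * B) m = (\<Sum>i\<in>{- int N..int N}. fls_nth A i * fls_nth B (m - i))"
    if N: "nat (\<bar>dA\<bar> + \<bar>m - dB\<bar>) \<le> N" for N
  proof -
    have "fls_nth (A * B) m = (\<Sum>i\<in>{dA..m - dB}. fls_nth A i * fls_nth B (m - i))"
      unfolding dA_def dB_def by (rule fls_times_nth(2))
    also have "\<dots> = (\<Sum>i\<in>{- int N..int N}. fls_nth A i * fls_nth B (m - i))"
    proof (rule sum.mono_neutral_left)
      show "\<forall>i\<in>{- int N..int N} - {dA..m - dB}. fls_nth A i * fls_nth B (m - i) = 0"
      proof
        fix i assume "i \<in> {- int N..int N} - {dA..m - dB}"
        then have "i < dA \<or> m - i < dB" by auto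
        then show "fls_nth A i * fls_nth B (m - i) = 0" by (auto simp: dA_def dB_def)
      qed
    qed (use N in auto)
    finally show ?thesis .
  qed
  then show thesis by (rule that)
qed

text \<open>A long partial sum of the product of \<open>a\<close> and \<open>b\<close> is within
  precision \<open>c\<close> of its limit and also of the coefficient of \<open>A * B\<close>, so
  these two are within \<open>c\<close> of each other.\<close>

lemma fls_approx_lmult:
  assumes a: "a \<in> lhat v" and b: "b \<in> lhat v" and A: "fls_approx c a A" and B: "fls_approx c b B"
  shows "fls_approx c (lmult v a b) (A * B)"
  unfolding fls_approx_def
proof safe
  fix m
  obtain N1 where N1:
    "\<And>N. N1 \<le> N \<Longrightarrow> fls_nth (A * B) m = (\<Sum>i\<in>{- int N..int N}. fls_nth A i * fls_nth B (m - i))"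
    using fls_times_nth_symmetric[of A B m] by blast
  show "0 \<le> v (fls_nth (A * B) m)"
    unfolding N1[OF order_refl]
  proof (rule v_sum_ge)
    fix i
    have "0 + 0 \<le> v (fls_nth A i * fls_nth B (m - i))"
      using A B by (intro v_mult_ge) (auto simp: fls_approx_def)
    then show "0 \<le> v (fls_nth A i * fls_nth B (m - i))" by simp
  qed
  obtain N2 where N2:
    "\<forall>N\<ge>N2. ereal c \<le> v ((\<Sum>i\<in>{- int N..int N}. a i * b (m - i)) - lmult v a b m)"
    using lmult_tendsto[OF a b, of m] unfolding val_tendsto_iff by blast
  define N where "N = max N1 N2"
  \<comment> \<open>Written as (a - A) b + A (b - B), each summand is an error of valuation at least
    \<open>c\<close> times an integral factor.\<close>
  have "ereal c \<le> v (a i * b (m - i) - fls_nth A i * fls_nth B (m - i))" for i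
  proof -
    have "ereal c + 0 \<le> v ((a i - fls_nth A i) * b (m - i))"
      using A lhat_nonneg[OF b] by (intro v_mult_ge) (auto simp: fls_approx_def)
    moreover have "0 + ereal c \<le> v (fls_nth A i * (b (m - i) - fls_nth B (m - i)))"
      using A B by (intro v_mult_ge) (auto simp: fls_approx_def)
    ultimately have "ereal c \<le> v ((a i - fls_nth A i) * b (m - i) + fls_nth A i * (b (m - i) - fls_nth B (m - i)))"
      by (intro v_add_ge) simp_all
    then show ?thesis by (simp add: algebra_simps)
  qed
  then have "ereal c \<le> v (\<Sum>i\<in>{- int N..int N}. a i * b (m - i) - fls_nth A i * fls_nth B (m - i))"
    by (rule v_sum_ge)
  moreover have "(\<Sum>i\<in>{- int N..int N}. a i * b (m - i) - fls_nth A i * fls_nth B (m - i))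
      = (\<Sum>i\<in>{- int N..int N}. a i * b (m - i)) - fls_nth (A * B) m"
    using N1[of N] by (simp add: sum_subtractf N_def)
  moreover have "ereal c \<le> v ((\<Sum>i\<in>{- int N..int N}. a i * b (m - i)) - lmult v a b m)"
    using N2 by (simp add: N_def)
  ultimately have "ereal c \<le> v (((\<Sum>i\<in>{- int N..int N}. a i * b (m - i)) - fls_nth (A * B) m)
      - ((\<Sum>i\<in>{- int N..int N}. a i * b (m - i)) - lmult v a b m))"
    by (intro v_diff_ge[of "ereal c" "_ - _" "_ - _"]) (simp_all only:)
  then show "ereal c \<le> v (lmult v a b m - fls_nth (A * B) m)" by simp
qed

text \<open>Decay at minus infinity is inherited from an approximation: \<open>A * B\<close>
  vanishes below the sum of the subdegrees, so there the product itself has valuation at least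
  \<open>c\<close>.\<close>

lemma lmult_closed:
  assumes a: "a \<in> lhat v" and b: "b \<in> lhat v" shows "lmult v a b \<in> lhat v"
  unfolding mem_lhat_iff
proof safe
  fix m
  show "0 \<le> v (lmult v a b m)"
    using v_mult_ge[OF lhat_nonneg[OF a] lhat_nonneg[OF b]] by (intro lmult_ge a b) simp
next
  fix c :: real
  obtain A where A: "fls_approx c a A" using ex_fls_approx[OF a] .
  obtain B where B: "fls_approx c b B" using ex_fls_approx[OF b] .
  have "ereal c \<le> v (lmult v a b m)" if "m < fls_subdegree A + fls_subdegree B" for m
    using fls_approx_lmult[OF a b A B] fls_times_nth_eq0[OF that]
    unfolding fls_approx_def by (metis diff_zero)
  then show "\<exists>k. \<forall>m<k. ereal c \<le> v (lmult v a b m)" by blast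
qed

lemma lhat_ring_simps:
  "carrier (lhat_ring v) = lhat v"
  "a \<otimes>\<^bsub>lhat_ring v\<^esub> b = lmult v a b"
  "\<one>\<^bsub>lhat_ring v\<^esub> = (\<lambda>m. if m = 0 then 1 else 0)"
  "\<zero>\<^bsub>lhat_ring v\<^esub> = (\<lambda>m. 0)"
  "a \<oplus>\<^bsub>lhat_ring v\<^esub> b = (\<lambda>m. a m + b m)"
  by (simp_all add: lhat_ring_def)

text \<open>The laws that involve products follow from the same laws for approximating Laurent
  series, at every precision.\<close>

lemma cring_lhat: "cring (lhat_ring v)"
proof (rule cringI)
  note lhat_ring_simps [simp]
  show "abelian_group (lhat_ring v)"
  proof (rule abelian_groupI)
    fix a assume "a \<in> carrier (lhat_ring v)"
    then have "(\<lambda>m. (- 1) * a m) \<in> lhat v" by (intro lhat_cmult) auto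
    then show "\<exists>b\<in>carrier (lhat_ring v). b \<oplus>\<^bsub>lhat_ring v\<^esub> a = \<zero>\<^bsub>lhat_ring v\<^esub>"
      by (intro bexI[of _ "\<lambda>m. (- 1) * a m"]) auto
  qed (simp_all add: lhat_add lhat_zero add_ac)
next
  note lhat_ring_simps [simp]
  show "comm_monoid (lhat_ring v)"
  proof (rule comm_monoidI)
    fix a b c assume "a \<in> carrier (lhat_ring v)" "b \<in> carrier (lhat_ring v)" "c \<in> carrier (lhat_ring v)"
    then have abc: "a \<in> lhat v" "b \<in> lhat v" "c \<in> lhat v" by simp_all
    have "lmult v (lmult v a b) c = lmult v a (lmult v b c)"
    proof (rule fls_approx_eqI)
      fix r
      obtain A where A: "fls_approx r a A" using ex_fls_approx[OF abc(1)] .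
      obtain B where B: "fls_approx r b B" using ex_fls_approx[OF abc(2)] .
      obtain C where C: "fls_approx r c C" using ex_fls_approx[OF abc(3)] .
      have "fls_approx r (lmult v (lmult v a b) c) (A * B * C)"
        by (intro fls_approx_lmult lmult_closed abc A B C)
      moreover have "fls_approx r (lmult v a (lmult v b c)) (A * (B * C))"
        by (intro fls_approx_lmult lmult_closed abc A B C)
      ultimately show "\<exists>A. fls_approx r (lmult v (lmult v a b) c) A \<and>
          fls_approx r (lmult v a (lmult v b c)) A"
        by (metis mult.assoc)
    qed
    then show "a \<otimes>\<^bsub>lhat_ring v\<^esub> b \<otimes>\<^bsub>lhat_ring v\<^esub> c = a \<otimes>\<^bsub>lhat_ring v\<^esub> (b \<otimes>\<^bsub>lhat_ring v\<^esub> c)"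
      by simp
  next
    fix a b assume "a \<in> carrier (lhat_ring v)" "b \<in> carrier (lhat_ring v)"
    then have ab: "a \<in> lhat v" "b \<in> lhat v" by simp_all
    have "lmult v a b = lmult v b a"
    proof (rule fls_approx_eqI)
      fix r
      obtain A where A: "fls_approx r a A" using ex_fls_approx[OF ab(1)] .
      obtain B where B: "fls_approx r b B" using ex_fls_approx[OF ab(2)] .
      have "fls_approx r (lmult v a b) (A * B)" "fls_approx r (lmult v b a) (B * A)"
        by (intro fls_approx_lmult ab A B)+
      then show "\<exists>A. fls_approx r (lmult v a b) A \<and> fls_approx r (lmult v b a) A"
        by (metis mult.commute)
    qed
    then show "a \<otimes>\<^bsub>lhat_ring v\<^esub> b = b \<otimes>\<^bsub>lhat_ring v\<^esub> a" by simp
  next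
    fix a assume "a \<in> carrier (lhat_ring v)"
    then have a: "a \<in> lhat v" by simp
    have "lmult v (\<lambda>m. if m = 0 then 1 else 0) a = a"
    proof (rule fls_approx_eqI)
      fix r
      obtain A where A: "fls_approx r a A" using ex_fls_approx[OF a] .
      have "fls_approx r (lmult v (\<lambda>m. if m = 0 then 1 else 0) a) (1 * A)"
        by (intro fls_approx_lmult fls_approx_one lhat_const a A) simp
      with A show "\<exists>A. fls_approx r (lmult v (\<lambda>m. if m = 0 then 1 else 0) a) A \<and> fls_approx r a A"
        by (metis mult_1)
    qed
    then show "\<one>\<^bsub>lhat_ring v\<^esub> \<otimes>\<^bsub>lhat_ring v\<^esub> a = a" by simp
  qed (simp_all add: lmult_closed lhat_const)
next
  fix a b c assume "a \<in> carrier (lhat_ring v)" "b \<in> carrier (lhat_ring v)" "c \<in> carrier (lhat_ring v)"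
  then have abc: "a \<in> lhat v" "b \<in> lhat v" "c \<in> lhat v" by (simp_all add: lhat_ring_simps)
  have "lmult v (\<lambda>m. a m + b m) c = (\<lambda>m. lmult v a c m + lmult v b c m)"
  proof (rule fls_approx_eqI)
    fix r
    obtain A where A: "fls_approx r a A" using ex_fls_approx[OF abc(1)] .
    obtain B where B: "fls_approx r b B" using ex_fls_approx[OF abc(2)] .
    obtain C where C: "fls_approx r c C" using ex_fls_approx[OF abc(3)] .
    have "fls_approx r (lmult v (\<lambda>m. a m + b m) c) ((A + B) * C)"
      by (intro fls_approx_lmult fls_approx_add lhat_add abc A B C)
    moreover have "fls_approx r (\<lambda>m. lmult v a c m + lmult v b c m) (A * C + B * C)"
      by (intro fls_approx_lmult fls_approx_add abc A B C)
    ultimately show "\<exists>A. fls_approx r (lmult v (\<lambda>m. a m + b m) c) A \<and>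
        fls_approx r (\<lambda>m. lmult v a c m + lmult v b c m) A"
      by (metis distrib_right)
  qed
  then show "(a \<oplus>\<^bsub>lhat_ring v\<^esub> b) \<otimes>\<^bsub>lhat_ring v\<^esub> c = a \<otimes>\<^bsub>lhat_ring v\<^esub> c \<oplus>\<^bsub>lhat_ring v\<^esub> b \<otimes>\<^bsub>lhat_ring v\<^esub> c"
    by (simp add: lhat_ring_simps)
qed

end

section \<open>Cramer's rule\<close>

context cring
begin

lemma finsum_swap:
  assumes A: "finite A" and B: "finite B" and g: "\<And>x y. x \<in> A \<Longrightarrow> y \<in> B \<Longrightarrow> g x y \<in> carrier R"
  shows "(\<Oplus>x\<in>A. \<Oplus>y\<in>B. g x y) = (\<Oplus>y\<in>B. \<Oplus>x\<in>A. g x y)"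
  using A g
proof (induction A)
  case (insert z A)
  have "(\<Oplus>x\<in>insert z A. \<Oplus>y\<in>B. g x y) = (\<Oplus>y\<in>B. g z y) \<oplus> (\<Oplus>x\<in>A. \<Oplus>y\<in>B. g x y)"
    using insert by (intro finsum_insert) (auto intro!: finsum_closed)
  also have "\<dots> = (\<Oplus>y\<in>B. g z y) \<oplus> (\<Oplus>y\<in>B. \<Oplus>x\<in>A. g x y)"
    using insert by simp
  also have "\<dots> = (\<Oplus>y\<in>B. g z y \<oplus> (\<Oplus>x\<in>A. g x y))"
    using insert.prems by (intro finsum_addf[symmetric]) (auto intro!: finsum_closed)
  also have "\<dots> = (\<Oplus>y\<in>B. \<Oplus>x\<in>insert z A. g x y)"
    using insert by (intro finsum_cong' refl finsum_insert[symmetric]) (auto intro!: finsum_closed)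
  finally show ?case .
qed simp

definition replace_col :: "(nat \<Rightarrow> nat \<Rightarrow> 'a) \<Rightarrow> nat \<Rightarrow> (nat \<Rightarrow> 'a) \<Rightarrow> nat \<Rightarrow> nat \<Rightarrow> 'a" where
  "replace_col M k c = (\<lambda>i j. if j = k then c i else M i j)"

abbreviation perm_sign :: "(nat \<Rightarrow> nat) \<Rightarrow> 'a" where
  "perm_sign \<tau> \<equiv> if evenperm \<tau> then \<one> else \<ominus> \<one>"

text \<open>The Leibniz term of \<tau> with its factor from column \<open>k\<close> removed;
  \<open>inv_into UNIV \<tau> k\<close> is the row in which \<tau> meets that column. The terms for
  which this row is \<open>i\<close> add up to the signed cofactor at position (i, k), so no
  submatrices need to be reindexed.\<close>

definition cofactor_term :: "nat set \<Rightarrow> (nat \<Rightarrow> nat \<Rightarrow> 'a) \<Rightarrow> nat \<Rightarrow> (nat \<Rightarrow> nat) \<Rightarrow> 'a" where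
  "cofactor_term I M k \<tau> = perm_sign \<tau> \<otimes> (\<Otimes>i\<in>I - {inv_into UNIV \<tau> k}. M i (\<tau> i))"

lemma cofactor_term_closed:
  assumes "\<tau> permutes I" "\<And>i j. i \<in> I \<Longrightarrow> j \<in> I \<Longrightarrow> M i j \<in> carrier R"
  shows "cofactor_term I M k \<tau> \<in> carrier R"
  unfolding cofactor_term_def using assms permutes_in_image[OF assms(1)]
  by (intro m_closed finprod_closed) auto

text \<open>Makes linearity in column \<open>k\<close> explicit: the weights
  \<open>cofactor_term I M k \<tau>\<close> do not see that column.\<close>

lemma rdet_replace_col:
  assumes I: "finite I" "k \<in> I" and M: "\<And>i j. i \<in> I \<Longrightarrow> j \<in> I \<Longrightarrow> M i j \<in> carrier R"
    and c: "\<And>i. i \<in> I \<Longrightarrow> c i \<in> carrier R"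
  shows "rdet R I (replace_col M k c) =
    (\<Oplus>\<tau>\<in>{\<tau>. \<tau> permutes I}. cofactor_term I M k \<tau> \<otimes> c (inv_into UNIV \<tau> k))"
  unfolding rdet_def
proof (rule finsum_cong')
  show "(\<lambda>\<tau>. cofactor_term I M k \<tau> \<otimes> c (inv_into UNIV \<tau> k)) \<in> {\<tau>. \<tau> permutes I} \<rightarrow> carrier R"
  proof
    fix \<tau> assume "\<tau> \<in> {\<tau>. \<tau> permutes I}"
    then have \<tau>: "\<tau> permutes I" by simp
    have "inv_into UNIV \<tau> k \<in> I" using permutes_in_image[OF permutes_inv[OF \<tau>]] I by simp
    then show "cofactor_term I M k \<tau> \<otimes> c (inv_into UNIV \<tau> k) \<in> carrier R"
      using cofactor_term_closed[OF \<tau> M] c by simp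
  qed
  fix \<tau> assume "\<tau> \<in> {\<tau>. \<tau> permutes I}"
  then have \<tau>: "\<tau> permutes I" by simp
  define i0 where "i0 = inv_into UNIV \<tau> k"
  have i0: "i0 \<in> I" unfolding i0_def using permutes_in_image[OF permutes_inv[OF \<tau>]] I by simp
  have \<tau>_k: "\<tau> i = k \<longleftrightarrow> i = i0" for i
    unfolding i0_def using permutes_inverses[OF \<tau>] by metis
  have in_I: "\<tau> i \<in> I" if "i \<in> I" for i using permutes_in_image[OF \<tau>] that by simp
  have "(\<Otimes>i\<in>I. replace_col M k c i (\<tau> i)) = (\<Otimes>i\<in>insert i0 (I - {i0}). replace_col M k c i (\<tau> i))"
    using i0 by (simp add: insert_absorb)
  also have "\<dots> = c i0 \<otimes> (\<Otimes>i\<in>I - {i0}. replace_col M k c i (\<tau> i))"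
    using I i0 c M in_I \<tau>_k by (subst finprod_insert) (auto simp: replace_col_def)
  also have "(\<Otimes>i\<in>I - {i0}. replace_col M k c i (\<tau> i)) = (\<Otimes>i\<in>I - {i0}. M i (\<tau> i))"
    using M in_I \<tau>_k by (intro finprod_cong') (auto simp: replace_col_def)
  finally have "perm_sign \<tau> \<otimes> (\<Otimes>i\<in>I. replace_col M k c i (\<tau> i))
      = perm_sign \<tau> \<otimes> (c i0 \<otimes> (\<Otimes>i\<in>I - {i0}. M i (\<tau> i)))" by simp
  also have "\<dots> = (perm_sign \<tau> \<otimes> (\<Otimes>i\<in>I - {i0}. M i (\<tau> i))) \<otimes> c i0"
    using c[OF i0] M in_I by (subst m_comm[of "c i0"]) (auto intro!: finprod_closed simp: m_assoc)
  finally show "perm_sign \<tau> \<otimes> (\<Otimes>i\<in>I. replace_col M k c i (\<tau> i))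
      = cofactor_term I M k \<tau> \<otimes> c (inv_into UNIV \<tau> k)"
    by (simp add: cofactor_term_def i0_def)
qed simp

lemma rdet_replace_col_sum:
  assumes I: "finite I" "k \<in> I" and M: "\<And>i j. i \<in> I \<Longrightarrow> j \<in> I \<Longrightarrow> M i j \<in> carrier R"
    and D: "\<And>i j. i \<in> I \<Longrightarrow> j \<in> I \<Longrightarrow> D i j \<in> carrier R"
    and s: "\<And>j. j \<in> I \<Longrightarrow> s j \<in> carrier R"
    and c: "\<And>i. i \<in> I \<Longrightarrow> c i = (\<Oplus>j\<in>I. D i j \<otimes> s j)"
  shows "rdet R I (replace_col M k c) = (\<Oplus>j\<in>I. rdet R I (replace_col M k (\<lambda>i. D i j)) \<otimes> s j)"
proof -
  let ?P = "{\<tau>. \<tau> permutes I}" and ?w = "cofactor_term I M k" and ?i = "\<lambda>\<tau>. inv_into UNIV \<tau> k"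
  have P: "finite ?P" using finite_permutations[OF I(1)] .
  have w: "?w \<tau> \<in> carrier R" if "\<tau> \<in> ?P" for \<tau> using cofactor_term_closed[OF _ M] that by simp
  have i: "?i \<tau> \<in> I" if "\<tau> \<in> ?P" for \<tau> using permutes_in_image[OF permutes_inv, of \<tau> I k] I that by simp
  have c_closed: "c i \<in> carrier R" if "i \<in> I" for i
    unfolding c[OF that] using that D s by (auto intro!: finsum_closed)
  have "rdet R I (replace_col M k c) = (\<Oplus>\<tau>\<in>?P. ?w \<tau> \<otimes> c (?i \<tau>))"
    by (rule rdet_replace_col[OF I M c_closed])
  also have "\<dots> = (\<Oplus>\<tau>\<in>?P. \<Oplus>j\<in>I. (?w \<tau> \<otimes> D (?i \<tau>) j) \<otimes> s j)"
  proof (rule finsum_cong')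
    fix \<tau> assume \<tau>: "\<tau> \<in> ?P"
    have "?w \<tau> \<otimes> c (?i \<tau>) = (\<Oplus>j\<in>I. ?w \<tau> \<otimes> (D (?i \<tau>) j \<otimes> s j))"
      unfolding c[OF i[OF \<tau>]] using I w[OF \<tau>] D[OF i[OF \<tau>]] s by (intro finsum_rdistr) auto
    also have "\<dots> = (\<Oplus>j\<in>I. (?w \<tau> \<otimes> D (?i \<tau>) j) \<otimes> s j)"
      using w[OF \<tau>] D[OF i[OF \<tau>]] s by (intro finsum_cong') (auto simp: m_assoc)
    finally show "?w \<tau> \<otimes> c (?i \<tau>) = (\<Oplus>j\<in>I. (?w \<tau> \<otimes> D (?i \<tau>) j) \<otimes> s j)" .
  qed (use w i D s in \<open>auto intro!: finsum_closed\<close>)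
  also have "\<dots> = (\<Oplus>j\<in>I. \<Oplus>\<tau>\<in>?P. (?w \<tau> \<otimes> D (?i \<tau>) j) \<otimes> s j)"
    using w i D s by (intro finsum_swap P I) simp
  also have "\<dots> = (\<Oplus>j\<in>I. rdet R I (replace_col M k (\<lambda>i. D i j)) \<otimes> s j)"
  proof (rule finsum_cong')
    have det: "rdet R I (replace_col M k (\<lambda>i. D i j)) = (\<Oplus>\<tau>\<in>?P. ?w \<tau> \<otimes> D (?i \<tau>) j)" if "j \<in> I" for j
      using D that by (intro rdet_replace_col I M) auto
    show "(\<lambda>j. rdet R I (replace_col M k (\<lambda>i. D i j)) \<otimes> s j) \<in> I \<rightarrow> carrier R"
      using w i D s by (auto simp: det intro!: finsum_closed)
    fix j assume j: "j \<in> I"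
    then show "(\<Oplus>\<tau>\<in>?P. (?w \<tau> \<otimes> D (?i \<tau>) j) \<otimes> s j) = rdet R I (replace_col M k (\<lambda>i. D i j)) \<otimes> s j"
      unfolding det[OF j] using P w i D s by (intro finsum_ldistr[symmetric]) auto
  qed simp
  finally show ?thesis .
qed

text \<open>Composing with the transposition of \<open>j\<close> and \<open>k\<close> matches even
  with odd permutations and leaves the product of entries unchanged, so the terms cancel in pairs.
  No division by two is involved.\<close>

lemma rdet_equal_cols:
  assumes I: "finite I" "j \<in> I" "k \<in> I" "j \<noteq> k"
    and M: "\<And>i j. i \<in> I \<Longrightarrow> j \<in> I \<Longrightarrow> M i j \<in> carrier R"
    and eq: "\<And>i. i \<in> I \<Longrightarrow> M i j = M i k"
  shows "rdet R I M = \<zero>"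
proof -
  let ?E = "{\<tau>. \<tau> permutes I \<and> evenperm \<tau>}" and ?O = "{\<tau>. \<tau> permutes I \<and> \<not> evenperm \<tau>}"
  define t where "t = (\<lambda>\<tau>. \<Otimes>i\<in>I. M i (\<tau> i))"
  let ?T = "transpose j k"
  have fin: "finite ?E" "finite ?O"
    using finite_permutations[OF I(1)] by (auto elim: rev_finite_subset)
  have T: "?T permutes I" using I by (intro permutes_swap_id)
  have t: "t \<tau> \<in> carrier R" if "\<tau> permutes I" for \<tau>
    unfolding t_def using M permutes_in_image[OF that] by (auto intro!: finprod_closed)
  have even: "evenperm (?T \<circ> \<tau>) \<longleftrightarrow> \<not> evenperm \<tau>" if "\<tau> permutes I" for \<tau>
    using evenperm_comp[of ?T \<tau>] permutes_imp_permutation[OF I(1)] T that I(4)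
    by (auto simp: evenperm_swap)
  have TT: "?T \<circ> (?T \<circ> \<tau>) = \<tau>" for \<tau> by (simp add: fun_eq_iff)
  have O_eq: "?O = (\<lambda>\<tau>. ?T \<circ> \<tau>) ` ?E"
  proof (rule Set.set_eqI, rule iffI)
    fix \<tau> assume \<tau>: "\<tau> \<in> ?O"
    then have "?T \<circ> \<tau> \<in> ?E" using even permutes_compose[OF _ T] by auto
    then show "\<tau> \<in> (\<lambda>\<tau>. ?T \<circ> \<tau>) ` ?E" using TT[of \<tau>] by (metis image_eqI)
  next
    fix \<tau> assume "\<tau> \<in> (\<lambda>\<tau>. ?T \<circ> \<tau>) ` ?E"
    then show "\<tau> \<in> ?O" using even permutes_compose[OF _ T] by auto
  qed
  have inj: "inj_on (\<lambda>\<tau>. ?T \<circ> \<tau>) ?E" by (rule inj_on_inverseI[where g = "\<lambda>\<tau>. ?T \<circ> \<tau>"]) (rule TT)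
  have t_T: "t (?T \<circ> \<tau>) = t \<tau>" if \<tau>: "\<tau> permutes I" for \<tau>
    unfolding t_def
  proof (rule finprod_cong')
    fix i assume i: "i \<in> I"
    show "M i ((?T \<circ> \<tau>) i) = M i (\<tau> i)" using eq[OF i] by (auto simp: transpose_def)
  qed (use M permutes_in_image[OF \<tau>] in auto)
  have "rdet R I M = (\<Oplus>\<tau>\<in>?E \<union> ?O. perm_sign \<tau> \<otimes> t \<tau>)"
    unfolding rdet_def t_def by (rule arg_cong[where f = "finsum R _"]) auto
  also have "\<dots> = (\<Oplus>\<tau>\<in>?E. perm_sign \<tau> \<otimes> t \<tau>) \<oplus> (\<Oplus>\<tau>\<in>?O. perm_sign \<tau> \<otimes> t \<tau>)"
    using fin t by (intro finsum_Un_disjoint) auto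
  also have "(\<Oplus>\<tau>\<in>?O. perm_sign \<tau> \<otimes> t \<tau>) = (\<Oplus>\<tau>\<in>?E. perm_sign (?T \<circ> \<tau>) \<otimes> t (?T \<circ> \<tau>))"
    unfolding O_eq using t permutes_compose[OF _ T] by (intro finsum_reindex inj) auto
  also have "(\<Oplus>\<tau>\<in>?E. perm_sign \<tau> \<otimes> t \<tau>) \<oplus> (\<Oplus>\<tau>\<in>?E. perm_sign (?T \<circ> \<tau>) \<otimes> t (?T \<circ> \<tau>))
      = (\<Oplus>\<tau>\<in>?E. perm_sign \<tau> \<otimes> t \<tau> \<oplus> perm_sign (?T \<circ> \<tau>) \<otimes> t (?T \<circ> \<tau>))"
    using t permutes_compose[OF _ T] by (intro finsum_addf[symmetric]) auto
  also have "\<dots> = (\<Oplus>\<tau>\<in>?E. \<zero>)"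
    using t by (intro finsum_cong') (auto simp: even t_T l_minus r_neg)
  finally show ?thesis by simp
qed

text \<open>Division-free form, so the determinant may be any ring element. This matters because it
  is later a unit constant plus a small series, and only the constant gets cancelled.\<close>

theorem cramer_rule:
  assumes I: "finite I" "k \<in> I" and M: "\<And>i j. i \<in> I \<Longrightarrow> j \<in> I \<Longrightarrow> M i j \<in> carrier R"
    and s: "\<And>j. j \<in> I \<Longrightarrow> s j \<in> carrier R"
    and c: "\<And>i. i \<in> I \<Longrightarrow> c i = (\<Oplus>j\<in>I. M i j \<otimes> s j)"
  shows "rdet R I M \<otimes> s k = rdet R I (replace_col M k c)"
proof -
  have same: "replace_col M k (\<lambda>i. M i k) = M" by (auto simp: replace_col_def fun_eq_iff)
  have closed: "rdet R I M \<in> carrier R"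
    unfolding rdet_def using M by (auto intro!: finsum_closed finprod_closed simp: permutes_in_image)
  have "rdet R I (replace_col M k c) = (\<Oplus>j\<in>I. rdet R I (replace_col M k (\<lambda>i. M i j)) \<otimes> s j)"
    using assms by (intro rdet_replace_col_sum)
  \<comment> \<open>For \<open>j\<close> other than \<open>k\<close>, column \<open>j\<close> of the
    matrix now occurs twice.\<close>
  also have "\<dots> = (\<Oplus>j\<in>I. if k = j then rdet R I M \<otimes> s j else \<zero>)"
  proof (rule finsum_cong')
    fix j assume j: "j \<in> I"
    show "rdet R I (replace_col M k (\<lambda>i. M i j)) \<otimes> s j = (if k = j then rdet R I M \<otimes> s j else \<zero>)"
    proof (cases "k = j")
      case False
      then have "rdet R I (replace_col M k (\<lambda>i. M i j)) = \<zero>"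
        using I j M by (intro rdet_equal_cols[of I j k]) (auto simp: replace_col_def)
      with False s[OF j] show ?thesis by simp
    qed (use same in simp)
  qed (use closed s in auto)
  also have "\<dots> = rdet R I M \<otimes> s k"
    using I closed s by (intro finsum_singleton) auto
  finally show ?thesis by simp
qed

end

section \<open>The variables of the system\<close>

lemma polys_UNIV_iff: "g \<in> polys UNIV V \<longleftrightarrow> (\<forall>u\<in>Poly_Mapping.keys g. Poly_Mapping.keys u \<subseteq> V)"
  by (simp add: polys_def)

lemma polys_zero: "0 \<in> polys UNIV V"
  by (simp add: polys_UNIV_iff)

lemma polys_mconst: "mconst c \<in> polys UNIV V"
  by (auto simp: polys_UNIV_iff mconst_def)

lemma polys_mvar: "i \<in> V \<Longrightarrow> mvar i \<in> polys UNIV V"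
  by (auto simp: polys_UNIV_iff mvar_def)

lemma polys_add: "g \<in> polys UNIV V \<Longrightarrow> h \<in> polys UNIV V \<Longrightarrow> g + h \<in> polys UNIV V"
  for g :: "'a::comm_ring_1 mpoly"
  using Poly_Mapping.keys_add[of g h] by (fastforce simp: polys_UNIV_iff)

lemma polys_diff: "g \<in> polys UNIV V \<Longrightarrow> h \<in> polys UNIV V \<Longrightarrow> g - h \<in> polys UNIV V"
  for g :: "'a::comm_ring_1 mpoly"
  using keys_diff[of g h] by (fastforce simp: polys_UNIV_iff)

lemma polys_mult:
  fixes g :: "'a::comm_ring_1 mpoly"
  assumes "g \<in> polys UNIV V" "h \<in> polys UNIV V" shows "g * h \<in> polys UNIV V"
  unfolding polys_UNIV_iff
proof
  fix u assume "u \<in> Poly_Mapping.keys (g * h)"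
  then obtain u1 u2 where u: "u = u1 + u2" "u1 \<in> Poly_Mapping.keys g" "u2 \<in> Poly_Mapping.keys h"
    using keys_mult[of g h] by blast
  have "Poly_Mapping.keys u \<subseteq> Poly_Mapping.keys u1 \<union> Poly_Mapping.keys u2"
    unfolding u(1) by (rule Poly_Mapping.keys_add)
  also have "\<dots> \<subseteq> V" using assms u by (auto simp: polys_UNIV_iff)
  finally show "Poly_Mapping.keys u \<subseteq> V" .
qed

lemma polys_one: "(1 :: 'a::comm_ring_1 mpoly) \<in> polys UNIV V"
  by (simp add: polys_UNIV_iff)

lemma polys_power: "g \<in> polys UNIV V \<Longrightarrow> g ^ k \<in> polys UNIV V"
  for g :: "'a::comm_ring_1 mpoly"
  by (induction k) (auto intro: polys_one polys_mult)

lemma polys_sum: "(\<And>i. i \<in> A \<Longrightarrow> g i \<in> polys UNIV V) \<Longrightarrow> sum g A \<in> polys UNIV V"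
  for g :: "'b \<Rightarrow> 'a::comm_ring_1 mpoly"
  by (induction A rule: infinite_finite_induct) (auto intro: polys_zero polys_add)

lemma polys_prod: "(\<And>i. i \<in> A \<Longrightarrow> g i \<in> polys UNIV V) \<Longrightarrow> prod g A \<in> polys UNIV V"
  for g :: "'b \<Rightarrow> 'a::comm_ring_1 mpoly"
  by (induction A rule: infinite_finite_induct) (auto intro: polys_one polys_mult)

lemma polys_meval:
  fixes y :: "nat \<Rightarrow> 'a::comm_ring_1 mpoly"
  assumes "\<And>c. \<phi> c \<in> polys UNIV V" "\<And>i. y i \<in> polys UNIV V"
  shows "meval \<phi> y g \<in> polys UNIV V"
  unfolding meval_def using assms by (intro polys_sum polys_mult polys_prod polys_power)

text \<open>The bounds assumed on coefficients speak only of exponent vectors supported in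
  \<open>{2..n}\<close>; this shows that no others occur. The variables x_i sit inside the
  coefficients and do not count.\<close>

lemma G_system_polys: "G_system \<sigma> p' n f P \<Delta> i \<in> polys UNIV {2..n}"
  unfolding G_system_def
  by (intro polys_diff polys_meval polys_add polys_sum polys_mult polys_mconst polys_mvar)

lemma H_system_nonzeroD:
  assumes "H_system v \<pi> \<sigma> p' \<iota> n x f P \<Delta> q t i u \<noteq> \<zero>\<^bsub>lhat_ring v\<^esub>"
  shows "u \<in> Poly_Mapping.keys (G_system \<sigma> p' n f P \<Delta> i)" "Poly_Mapping.keys u \<subseteq> {2..n}"
proof -
  show u: "u \<in> Poly_Mapping.keys (G_system \<sigma> p' n f P \<Delta> i)"
    using assms unfolding H_system_def by metis
  show "Poly_Mapping.keys u \<subseteq> {2..n}"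
    using G_system_polys[of \<sigma> p' n f P \<Delta> i] u unfolding polys_UNIV_iff by blast
qed

lemma finite_H_system: "finite {u. H_system v \<pi> \<sigma> p' \<iota> n x f P \<Delta> q t i u \<noteq> \<zero>\<^bsub>lhat_ring v\<^esub>}"
  by (rule finite_subset[OF _ finite_keys[of "G_system \<sigma> p' n f P \<Delta> i"]]) (use H_system_nonzeroD in blast)

text \<open>Coefficients in degrees above the degree of the system vanish, so bounds up to
  \<open>N\<close> cover the whole system. Finiteness is what makes \<open>Max\<close> meaningful
  here.\<close>

lemma total_deg_le_sys_degree:
  assumes i: "i \<in> {2..n}" and nz: "H i u \<noteq> \<zero>\<^bsub>lhat_ring v\<^esub>"
    and fin: "\<And>i. i \<in> {2..n} \<Longrightarrow> finite {u. H i u \<noteq> \<zero>\<^bsub>lhat_ring v\<^esub>}"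
  shows "total_deg u \<le> sys_degree v n H"
  unfolding sys_degree_def
proof (rule Max_ge)
  have "{total_deg u | i u. i \<in> {2..n} \<and> H i u \<noteq> \<zero>\<^bsub>lhat_ring v\<^esub>}
      = (\<Union>i\<in>{2..n}. total_deg ` {u. H i u \<noteq> \<zero>\<^bsub>lhat_ring v\<^esub>})" by blast
  also have "finite \<dots>" using fin by blast
  finally show "finite (insert 0 {total_deg u | i u. i \<in> {2..n} \<and> H i u \<noteq> \<zero>\<^bsub>lhat_ring v\<^esub>})" by simp
qed (use i nz in blast)

lemma total_deg_zero: "total_deg 0 = 0"
  by (simp add: total_deg_def)

lemma total_deg_single: "total_deg (Poly_Mapping.single j 1) = 1"
  by (simp add: total_deg_def)

lemma total_deg_eq_0D: "total_deg u = 0 \<Longrightarrow> u = 0"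
  by (rule poly_mapping_eqI) (auto simp: total_deg_def in_keys_iff)

lemma total_deg_eq_1D:
  assumes "total_deg u = 1" obtains j where "u = Poly_Mapping.single j 1"
proof -
  obtain j where j: "j \<in> Poly_Mapping.keys u" "Poly_Mapping.lookup u j = 1"
    "\<forall>b\<in>Poly_Mapping.keys u. j \<noteq> b \<longrightarrow> Poly_Mapping.lookup u b = 0"
    using assms[unfolded total_deg_def sum_eq_1_iff[OF finite_keys]] by blast
  have "u = Poly_Mapping.single j 1"
    using j by (intro poly_mapping_eqI) (auto simp: lookup_single when_def in_keys_iff)
  then show thesis by (rule that)
qed

section \<open>Series with linearly bounded valuations\<close>

context complete_valued_field
begin

interpretation L: cring "lhat_ring v" by (rule cring_lhat)

text \<open>The summand \<open>c\<close> of the minimum measures how far an iteration towards the slope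
  \<open>al\<close> has progressed: a series in \<open>approx_bounded al c0 \<beta> c\<close> satisfies the bound of slope \<open>al\<close>
  up to an error of valuation \<open>c\<close>.\<close>

definition approx_bounded :: "real \<Rightarrow> real \<Rightarrow> real \<Rightarrow> real \<Rightarrow> (int \<Rightarrow> 'k) set" where
  "approx_bounded al c0 \<beta> c =
     {a \<in> lhat v. \<forall>m. ereal c0 \<le> v (a m) \<and> ereal (min c (\<beta> - al * real_of_int m)) \<le> v (a m)}"

text \<open>The case without error term. In both definitions \<open>c0\<close> is a lower bound
  uniform in \<open>m\<close>; it records divisibility by a power of pi, which is what improves the
  precision in products.\<close>

definition slope_bounded :: "real \<Rightarrow> real \<Rightarrow> real \<Rightarrow> (int \<Rightarrow> 'k) set" where
  "slope_bounded al c0 \<beta> =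
     {a \<in> lhat v. \<forall>m. ereal c0 \<le> v (a m) \<and> ereal (\<beta> - al * real_of_int m) \<le> v (a m)}"

lemma approx_bounded_lhat: "a \<in> approx_bounded al c0 \<beta> c \<Longrightarrow> a \<in> lhat v"
  by (simp add: approx_bounded_def)

lemma approx_bounded_carrier: "a \<in> approx_bounded al c0 \<beta> c \<Longrightarrow> a \<in> carrier (lhat_ring v)"
  by (simp add: approx_bounded_def lhat_ring_simps)

lemma slope_bounded_imp_approx_bounded: 
  assumes "a \<in> slope_bounded al c0 \<beta>" shows "a \<in> approx_bounded al c0 \<beta> c"
proof -
  have "ereal (min c (\<beta> - al * real_of_int m)) \<le> v (a m)" for m
  proof -
    have "ereal (min c (\<beta> - al * real_of_int m)) \<le> ereal (\<beta> - al * real_of_int m)" by simp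
    also have "\<dots> \<le> v (a m)" using assms by (simp add: slope_bounded_def)
    finally show ?thesis .
  qed
  with assms show ?thesis by (simp add: approx_bounded_def slope_bounded_def)
qed

lemma approx_bounded_mono:
  assumes a: "a \<in> approx_bounded al c0 \<beta> c" and le: "c0' \<le> c0" "\<beta>' \<le> \<beta>" "c' \<le> c"
  shows "a \<in> approx_bounded al c0' \<beta>' c'"
proof -
  have "ereal c0' \<le> v (a m)" "ereal (min c' (\<beta>' - al * real_of_int m)) \<le> v (a m)" for m
  proof -
    have "ereal c0' \<le> ereal c0" using le by simp
    also have "\<dots> \<le> v (a m)" using a by (simp add: approx_bounded_def)
    finally show "ereal c0' \<le> v (a m)" .
    have "ereal (min c' (\<beta>' - al * real_of_int m)) \<le> ereal (min c (\<beta> - al * real_of_int m))"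
      unfolding ereal_less_eq using le by (intro min.mono) auto
    also have "\<dots> \<le> v (a m)" using a by (simp add: approx_bounded_def)
    finally show "ereal (min c' (\<beta>' - al * real_of_int m)) \<le> v (a m)" .
  qed
  with a show ?thesis by (simp add: approx_bounded_def)
qed

lemma approx_bounded_zero: "\<zero>\<^bsub>lhat_ring v\<^esub> \<in> approx_bounded al c0 \<beta> c"
  by (simp add: approx_bounded_def lhat_ring_simps lhat_zero)

lemma approx_bounded_one: "\<one>\<^bsub>lhat_ring v\<^esub> \<in> approx_bounded al 0 0 c"
  by (auto simp: approx_bounded_def lhat_ring_simps lhat_const zero_ereal_def[symmetric] min_le_iff_disj
      ereal_min[symmetric] simp del: ereal_min)

lemma approx_bounded_add:
  assumes "a \<in> approx_bounded al c0 \<beta> c" "b \<in> approx_bounded al c0 \<beta> c"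
  shows "a \<oplus>\<^bsub>lhat_ring v\<^esub> b \<in> approx_bounded al c0 \<beta> c"
proof -
  have "ereal c0 \<le> v (a m + b m)" "ereal (min c (\<beta> - al * real_of_int m)) \<le> v (a m + b m)" for m
    using assms unfolding approx_bounded_def by (blast intro: v_add_ge)+
  then show ?thesis
    using assms lhat_add unfolding approx_bounded_def lhat_ring_simps by blast
qed

lemma lhat_ring_minus:
  assumes "a \<in> lhat v" shows "\<ominus>\<^bsub>lhat_ring v\<^esub> a = (\<lambda>m. - a m)"
proof (rule L.minus_equality)
  have "(\<lambda>m. (- 1) * a m) \<in> lhat v" using assms by (intro lhat_cmult) auto
  then show "(\<lambda>m. - a m) \<in> carrier (lhat_ring v)" by (simp add: lhat_ring_simps)
qed (use assms in \<open>auto simp: lhat_ring_simps\<close>)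

lemma approx_bounded_minus:
  assumes a: "a \<in> approx_bounded al c0 \<beta> c" shows "\<ominus>\<^bsub>lhat_ring v\<^esub> a \<in> approx_bounded al c0 \<beta> c"
proof -
  have "\<ominus>\<^bsub>lhat_ring v\<^esub> a \<in> lhat v"
    using L.a_inv_closed[OF approx_bounded_carrier[OF a]] by (simp add: lhat_ring_simps)
  then show ?thesis
    using a unfolding lhat_ring_minus[OF approx_bounded_lhat[OF a]] approx_bounded_def by simp
qed

text \<open>An error in one factor is multiplied by the other factor, so its valuation rises by the
  uniform bound of that factor. Where neither error matters, the two linear bounds add up.\<close>

lemma approx_bounded_mult:
  assumes a: "a \<in> approx_bounded al c0 \<beta> c" and b: "b \<in> approx_bounded al c0' \<beta>' c'"
  shows "a \<otimes>\<^bsub>lhat_ring v\<^esub> b \<in> approx_bounded al (c0 + c0') (\<beta> + \<beta>') (min (c + c0') (c' + c0))"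
proof -
  note lh = approx_bounded_lhat[OF a] approx_bounded_lhat[OF b]
  have "ereal (c0 + c0') \<le> v (a i * b (m - i))" for i m
  proof -
    have "ereal c0 + ereal c0' \<le> v (a i * b (m - i))"
      using a b by (intro v_mult_ge) (auto simp: approx_bounded_def)
    then show ?thesis by simp
  qed
  moreover have "ereal (min (min (c + c0') (c' + c0)) (\<beta> + \<beta>' - al * real_of_int m)) \<le> v (a i * b (m - i))"
    (is "ereal ?r \<le> _") for i m
  proof -
    define x where "x = \<beta> - al * real_of_int i"
    define y where "y = \<beta>' - al * real_of_int (m - i)"
    have xy: "x + y = \<beta> + \<beta>' - al * real_of_int m" by (simp add: x_def y_def algebra_simps)
    have ax: "ereal c0 \<le> v (a i)" "ereal (min c x) \<le> v (a i)"
      and bx: "ereal c0' \<le> v (b (m - i))" "ereal (min c' y) \<le> v (b (m - i))"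
      using a b unfolding approx_bounded_def x_def y_def by blast+
    \<comment> \<open>At least one factor is limited by its error, or both obey their lines. In the
      last case the indices \<open>i\<close> and \<open>m - i\<close> add to \<open>m\<close>, which
      is \<open>xy\<close>.\<close>
    consider "c \<le> x" | "c' \<le> y" | "x \<le> c" "y \<le> c'" by linarith
    then obtain s s' where s: "ereal s \<le> v (a i)" "ereal s' \<le> v (b (m - i))" "?r \<le> s + s'"
    proof cases
      case 1
      then show ?thesis using ax(2) bx(1) by (intro that[of c c0']) (auto simp: min_def)
    next
      case 2
      then show ?thesis using ax(1) bx(2) by (intro that[of c0 c']) (auto simp: min_def)
    next
      case 3
      then have "min c x = x" "min c' y = y" by simp_all
      then show ?thesis using ax(2) bx(2) xy by (intro that[of x y]) simp_all
    qed
    have "ereal ?r \<le> ereal (s + s')" using s(3) by (simp only: ereal_less_eq)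
    also have "\<dots> = ereal s + ereal s'" by simp
    also have "\<dots> \<le> v (a i * b (m - i))" by (intro v_mult_ge s)
    finally show ?thesis .
  qed
  ultimately show ?thesis
    using lmult_closed[OF lh] unfolding approx_bounded_def lhat_ring_simps
    by (intro CollectI conjI allI lmult_ge lh)
qed

lemma approx_bounded_finsum:
  assumes "\<And>i. i \<in> A \<Longrightarrow> g i \<in> approx_bounded al c0 \<beta> c"
  shows "(\<Oplus>\<^bsub>lhat_ring v\<^esub>i\<in>A. g i) \<in> approx_bounded al c0 \<beta> c"
  using assms
proof (induction A rule: infinite_finite_induct)
  case (insert x A)
  then have "(\<Oplus>\<^bsub>lhat_ring v\<^esub>i\<in>insert x A. g i) = g x \<oplus>\<^bsub>lhat_ring v\<^esub> (\<Oplus>\<^bsub>lhat_ring v\<^esub>i\<in>A. g i)"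
    by (intro L.finsum_insert) (auto intro: approx_bounded_carrier)
  with insert show ?case by (simp add: approx_bounded_add)
qed (auto intro: approx_bounded_zero)

text \<open>Stated for an arbitrary family closed under graded multiplication because two gradings
  occur: by the intercept for determinants, and by the degree for monomials.\<close>

lemma graded_finprod:
  fixes S :: "'g::comm_monoid_add \<Rightarrow> (int \<Rightarrow> 'k) set"
  assumes S: "\<And>d. S d \<subseteq> carrier (lhat_ring v)" "\<one>\<^bsub>lhat_ring v\<^esub> \<in> S 0"
    "\<And>d d' a b. a \<in> S d \<Longrightarrow> b \<in> S d' \<Longrightarrow> a \<otimes>\<^bsub>lhat_ring v\<^esub> b \<in> S (d + d')"
    and fin: "finite A" and g: "\<And>i. i \<in> A \<Longrightarrow> g i \<in> S (d i)"
  shows "(\<Otimes>\<^bsub>lhat_ring v\<^esub>i\<in>A. g i) \<in> S (\<Sum>i\<in>A. d i)"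
  using fin g
proof (induction A)
  case (insert x A)
  then have "(\<Otimes>\<^bsub>lhat_ring v\<^esub>i\<in>insert x A. g i) = g x \<otimes>\<^bsub>lhat_ring v\<^esub> (\<Otimes>\<^bsub>lhat_ring v\<^esub>i\<in>A. g i)"
    using S(1) by (intro L.finprod_insert) auto
  with insert show ?case by (simp add: S(3))
qed (use S in simp)

lemma graded_pow:
  fixes S :: "nat \<Rightarrow> (int \<Rightarrow> 'k) set"
  assumes S: "\<one>\<^bsub>lhat_ring v\<^esub> \<in> S 0"
    "\<And>d d' a b. a \<in> S d \<Longrightarrow> b \<in> S d' \<Longrightarrow> a \<otimes>\<^bsub>lhat_ring v\<^esub> b \<in> S (d + d')"
    and a: "a \<in> S 1"
  shows "a [^]\<^bsub>lhat_ring v\<^esub> (k::nat) \<in> S k"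
  using S(2)[OF _ a] by (induction k) (auto simp: S(1))

text \<open>Each Leibniz product contains exactly one entry of the replaced column. All other
  entries have uniform bound 0 and intercept 0, so intercept and precision of the new column pass
  unchanged to the determinant.\<close>

lemma approx_bounded_rdet:
  assumes I: "finite I" "k \<in> I" and M: "\<And>i j. i \<in> I \<Longrightarrow> j \<in> I \<Longrightarrow> M i j \<in> slope_bounded al 0 0"
    and c: "\<And>i. i \<in> I \<Longrightarrow> w i \<in> approx_bounded al 0 \<beta> c"
  shows "rdet (lhat_ring v) I (L.replace_col M k w) \<in> approx_bounded al 0 \<beta> c"
  unfolding rdet_def
proof (rule approx_bounded_finsum)
  fix \<tau> assume "\<tau> \<in> {\<tau>. \<tau> permutes I}"
  then have \<tau>: "\<tau> permutes I" by simp
  define i0 where "i0 = inv_into UNIV \<tau> k"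
  have i0: "i0 \<in> I" unfolding i0_def using permutes_in_image[OF permutes_inv[OF \<tau>]] I by simp
  have \<tau>_k: "\<tau> i = k \<longleftrightarrow> i = i0" for i
    unfolding i0_def using permutes_inverses[OF \<tau>] by metis
  have "(\<Otimes>\<^bsub>lhat_ring v\<^esub>i\<in>I. L.replace_col M k w i (\<tau> i))
      \<in> approx_bounded al 0 (\<Sum>i\<in>I. if i = i0 then \<beta> else 0) c"
  proof (rule graded_finprod[of "\<lambda>\<beta>. approx_bounded al 0 \<beta> c"])
    fix i assume "i \<in> I"
    then show "L.replace_col M k w i (\<tau> i) \<in> approx_bounded al 0 (if i = i0 then \<beta> else 0) c"
      using \<tau>_k[of i] c[of i] M[of i "\<tau> i"] permutes_in_image[OF \<tau>, of i]
      by (auto simp: L.replace_col_def intro: slope_bounded_imp_approx_bounded)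
  next
    fix d d' a b assume "a \<in> approx_bounded al 0 d c" "b \<in> approx_bounded al 0 d' c"
    from approx_bounded_mult[OF this] show "a \<otimes>\<^bsub>lhat_ring v\<^esub> b \<in> approx_bounded al 0 (d + d') c" by simp
  qed (use I in \<open>auto intro: approx_bounded_carrier approx_bounded_one\<close>)
  then have p: "(\<Otimes>\<^bsub>lhat_ring v\<^esub>i\<in>I. L.replace_col M k w i (\<tau> i)) \<in> approx_bounded al 0 \<beta> c"
    using I i0 by simp
  have "L.perm_sign \<tau> \<in> approx_bounded al 0 0 c"
    by (auto intro: approx_bounded_one approx_bounded_minus)
  from approx_bounded_mult[OF this p]
  show "L.perm_sign \<tau> \<otimes>\<^bsub>lhat_ring v\<^esub> (\<Otimes>\<^bsub>lhat_ring v\<^esub>i\<in>I. L.replace_col M k w i (\<tau> i))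
      \<in> approx_bounded al 0 \<beta> c" by simp
qed

lemma lmult_const:
  assumes r: "0 \<le> v r" and a: "a \<in> lhat v"
  shows "lmult v (\<lambda>m. if m = 0 then r else 0) a = (\<lambda>m. r * a m)"
proof
  fix m
  have "(\<Sum>i\<in>{- int N..int N}. (if i = 0 then r else 0) * a (m - i)) = r * a m" for N
    by (simp add: if_distrib[of "\<lambda>x. x * _"] cong: if_cong)
  then have "val_tendsto v (\<lambda>N. r * a m) (lmult v (\<lambda>m. if m = 0 then r else 0) a m)"
    using lmult_tendsto[OF lhat_const[OF r] a, of m] by simp
  moreover have "val_tendsto v (\<lambda>N. r * a m) (r * a m)" by (simp add: val_tendsto_iff)
  ultimately show "lmult v (\<lambda>m. if m = 0 then r else 0) a m = r * a m" by (rule val_tendsto_unique)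
qed

section \<open>Monomials and the splitting of the system by degree\<close>

definition monomial :: "(nat \<Rightarrow> int \<Rightarrow> 'k) \<Rightarrow> (nat \<Rightarrow>\<^sub>0 nat) \<Rightarrow> int \<Rightarrow> 'k" where
  "monomial s u = (\<Otimes>\<^bsub>lhat_ring v\<^esub>j\<in>Poly_Mapping.keys u. s j [^]\<^bsub>lhat_ring v\<^esub> Poly_Mapping.lookup u j)"

lemma monomial_closed:
  assumes "\<And>j. j \<in> Poly_Mapping.keys u \<Longrightarrow> s j \<in> carrier (lhat_ring v)"
  shows "monomial s u \<in> carrier (lhat_ring v)"
  unfolding monomial_def using assms by (intro L.finprod_closed) auto

lemma monomial_zero: "monomial s 0 = \<one>\<^bsub>lhat_ring v\<^esub>"
  by (simp add: monomial_def)

lemma monomial_single: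
  assumes "s j \<in> carrier (lhat_ring v)" shows "monomial s (Poly_Mapping.single j 1) = s j"
  using assms by (simp add: monomial_def)

text \<open>In a product of l coordinates, the error of one of them, of valuation \<rho> J, is
  multiplied by l - 1 others, each of valuation at least \<rho>.\<close>

lemma approx_bounded_monomial:
  assumes s: "\<And>j. j \<in> Poly_Mapping.keys u \<Longrightarrow> s j \<in> approx_bounded al \<rho> \<kappa> (\<rho> * J)"
  shows "monomial s u \<in> approx_bounded al (\<rho> * total_deg u) (\<kappa> * total_deg u) (\<rho> * (J + total_deg u - 1))"
proof -
  \<comment> \<open>The precision is affine in the degree so that the grading is additive. In degree
    0 it is below that of a single coordinate, which is harmless, since \<open>\<one>\<close> meets
    its bound at every precision.\<close>
  define S where "S l = approx_bounded al (\<rho> * real l) (\<kappa> * real l) (\<rho> * (J + real l - 1))" for l :: nat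
  have S0: "\<one>\<^bsub>lhat_ring v\<^esub> \<in> S 0" unfolding S_def using approx_bounded_one by simp
  have S_mult: "a \<otimes>\<^bsub>lhat_ring v\<^esub> b \<in> S (l + l')" if "a \<in> S l" "b \<in> S l'" for l l' a b
    using approx_bounded_mult[OF that[unfolded S_def]] unfolding S_def by (simp add: algebra_simps)
  have "monomial s u \<in> S (\<Sum>j\<in>Poly_Mapping.keys u. Poly_Mapping.lookup u j)"
    unfolding monomial_def
  proof (rule graded_finprod[where S = S])
    fix j assume "j \<in> Poly_Mapping.keys u"
    then have "s j \<in> S 1" using s by (simp add: S_def)
    show "s j [^]\<^bsub>lhat_ring v\<^esub> Poly_Mapping.lookup u j \<in> S (Poly_Mapping.lookup u j)"
      by (rule graded_pow[of S, OF S0 _ \<open>s j \<in> S 1\<close>]) (rule S_mult)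
  qed (use S0 S_mult in \<open>auto simp: S_def intro: approx_bounded_carrier\<close>)
  then show ?thesis by (simp add: S_def total_deg_def)
qed

text \<open>The linear part runs over all of \<open>I\<close>, including variables whose coefficient
  is zero, because Cramer's rule needs a full square matrix.\<close>

lemma sys_eval_split:
  assumes I: "finite I" and fin: "finite {u. h u \<noteq> \<zero>\<^bsub>lhat_ring v\<^esub>}"
    and supp: "\<And>u. h u \<noteq> \<zero>\<^bsub>lhat_ring v\<^esub> \<Longrightarrow> Poly_Mapping.keys u \<subseteq> I"
    and h: "\<And>u. h u \<in> carrier (lhat_ring v)" and s: "\<And>j. j \<in> I \<Longrightarrow> s j \<in> carrier (lhat_ring v)"
  shows "sys_eval v h s = h 0 \<oplus>\<^bsub>lhat_ring v\<^esub>
      (\<Oplus>\<^bsub>lhat_ring v\<^esub>j\<in>I. h (Poly_Mapping.single j 1) \<otimes>\<^bsub>lhat_ring v\<^esub> s j) \<oplus>\<^bsub>lhat_ring v\<^esub>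
      (\<Oplus>\<^bsub>lhat_ring v\<^esub>u\<in>{u. h u \<noteq> \<zero>\<^bsub>lhat_ring v\<^esub> \<and> 2 \<le> total_deg u}. h u \<otimes>\<^bsub>lhat_ring v\<^esub> monomial s u)"
proof -
  let ?U = "{u. h u \<noteq> \<zero>\<^bsub>lhat_ring v\<^esub>}" and ?U2 = "{u. h u \<noteq> \<zero>\<^bsub>lhat_ring v\<^esub> \<and> 2 \<le> total_deg u}"
  let ?g = "\<lambda>u. h u \<otimes>\<^bsub>lhat_ring v\<^esub> monomial s u"
  define U1 where "U1 = (\<lambda>j. Poly_Mapping.single j (1::nat)) ` I"
  have mono: "monomial s u \<in> carrier (lhat_ring v)" if "Poly_Mapping.keys u \<subseteq> I" for u
    using that s by (intro monomial_closed) auto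
  have keys: "Poly_Mapping.keys u \<subseteq> I" if "u \<in> ?U \<union> insert 0 U1" for u
    using that supp by (auto simp: U1_def split: if_splits)
  have g: "?g u \<in> carrier (lhat_ring v)" if "u \<in> ?U \<union> insert 0 U1" for u
    using h mono[OF keys[OF that]] by simp
  have U2: "finite ?U2" by (rule finite_subset[OF _ fin]) auto
  have U1: "finite U1" using I by (simp add: U1_def)
  have deg1: "total_deg u = 1" if "u \<in> U1" for u using that total_deg_single by (auto simp: U1_def)
  have "sys_eval v h s = (\<Oplus>\<^bsub>lhat_ring v\<^esub>u\<in>?U. ?g u)"
    by (simp add: sys_eval_def monomial_def)
  \<comment> \<open>The index set is enlarged by 0 and by all linear exponents; those not in the
    support contribute zero.\<close>
  also have "\<dots> = (\<Oplus>\<^bsub>lhat_ring v\<^esub>u\<in>insert 0 (U1 \<union> ?U2). ?g u)"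
  proof (rule L.add.finprod_mono_neutral_cong_left)
    show "?U \<subseteq> insert 0 (U1 \<union> ?U2)"
    proof
      fix u assume u: "u \<in> ?U"
      consider "total_deg u = 0" | "total_deg u = 1" | "2 \<le> total_deg u" by linarith
      then show "u \<in> insert 0 (U1 \<union> ?U2)"
      proof cases
        case 1
        then show ?thesis using total_deg_eq_0D by blast
      next
        case 2
        then obtain j where j: "u = Poly_Mapping.single j 1" by (rule total_deg_eq_1D)
        with supp[of u] u have "j \<in> I" by simp
        with j show ?thesis by (auto simp: U1_def)
      qed (use u in simp)
    qed
    show "?g u = \<zero>\<^bsub>lhat_ring v\<^esub>" if "u \<in> insert 0 (U1 \<union> ?U2) - ?U" for u
      using that mono[OF keys, of u] by auto
  qed (use U1 U2 g in auto)
  also have "\<dots> = ?g 0 \<oplus>\<^bsub>lhat_ring v\<^esub> (\<Oplus>\<^bsub>lhat_ring v\<^esub>u\<in>U1 \<union> ?U2. ?g u)"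
    using U1 U2 g deg1 total_deg_zero by (intro L.finsum_insert) auto
  also have "(\<Oplus>\<^bsub>lhat_ring v\<^esub>u\<in>U1 \<union> ?U2. ?g u)
      = (\<Oplus>\<^bsub>lhat_ring v\<^esub>u\<in>U1. ?g u) \<oplus>\<^bsub>lhat_ring v\<^esub> (\<Oplus>\<^bsub>lhat_ring v\<^esub>u\<in>?U2. ?g u)"
    using U1 U2 g deg1 by (intro L.finsum_Un_disjoint) fastforce+
  also have "(\<Oplus>\<^bsub>lhat_ring v\<^esub>u\<in>U1. ?g u) = (\<Oplus>\<^bsub>lhat_ring v\<^esub>j\<in>I. ?g (Poly_Mapping.single j 1))"
    unfolding U1_def
  proof (rule L.finsum_reindex)
    show "inj_on (\<lambda>j. Poly_Mapping.single j (1::nat)) I"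
      by (intro inj_onI) (metis keys_single singleton_inject zero_neq_one)
  qed (use g in \<open>auto simp: U1_def\<close>)
  also have "\<dots> = (\<Oplus>\<^bsub>lhat_ring v\<^esub>j\<in>I. h (Poly_Mapping.single j 1) \<otimes>\<^bsub>lhat_ring v\<^esub> s j)"
    using h s by (intro L.finsum_cong') (simp_all add: monomial_single del: One_nat_def)
  also have "?g 0 = h 0" using h by (simp add: monomial_zero)
  finally show ?thesis
    using h s g by (subst L.a_assoc) (auto intro!: L.finsum_closed)
qed

end

section \<open>Bounding the solution\<close>

context complete_valued_field
begin

interpretation L: cring "lhat_ring v" by (rule cring_lhat)

lemma slope_bounded_carrier: "a \<in> slope_bounded al c0 \<beta> \<Longrightarrow> a \<in> carrier (lhat_ring v)"
  by (simp add: slope_bounded_def lhat_ring_simps)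

text \<open>Here \<open>w\<close> is the right-hand side of the linear system, \<kappa> is the
  intercept wanted for \<open>s\<close>, and \<rho> is a common positive lower bound for the
  valuations of \<open>s\<close> and \<open>y\<close>. Each step gains exactly \<rho>.\<close>

lemma solution_approx_step:
  fixes h :: "nat \<Rightarrow> (nat \<Rightarrow>\<^sub>0 nat) \<Rightarrow> int \<Rightarrow> 'k"
  assumes I: "finite I" and \<rho>: "0 < \<rho>"
    and fin: "\<And>i. i \<in> I \<Longrightarrow> finite {u. h i u \<noteq> \<zero>\<^bsub>lhat_ring v\<^esub>}"
    and supp: "\<And>i u. i \<in> I \<Longrightarrow> h i u \<noteq> \<zero>\<^bsub>lhat_ring v\<^esub> \<Longrightarrow> Poly_Mapping.keys u \<subseteq> I"
    and h0: "\<And>i. i \<in> I \<Longrightarrow> h i 0 \<in> slope_bounded al 0 \<kappa>"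
    and h1: "\<And>i j. i \<in> I \<Longrightarrow> j \<in> I \<Longrightarrow> h i (Poly_Mapping.single j 1) \<in> slope_bounded al 0 0"
    and h2: "\<And>i u. i \<in> I \<Longrightarrow> Poly_Mapping.keys u \<subseteq> I \<Longrightarrow> 2 \<le> total_deg u \<Longrightarrow>
      h i u \<in> slope_bounded al 0 (\<kappa> - \<kappa> * total_deg u)"
    and det: "rdet (lhat_ring v) I (\<lambda>i j. h i (Poly_Mapping.single j 1))
        = (\<lambda>m. (if m = 0 then r else 0) + y m)" "v r = 0" "y \<in> slope_bounded al \<rho> 0"
    and sol: "\<And>i. i \<in> I \<Longrightarrow> sys_eval v (h i) s = \<zero>\<^bsub>lhat_ring v\<^esub>"
    and s: "\<And>i. i \<in> I \<Longrightarrow> s i \<in> approx_bounded al \<rho> \<kappa> (\<rho> * real J)"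
    and k: "k \<in> I"
  shows "s k \<in> approx_bounded al \<rho> \<kappa> (\<rho> * real (Suc J))"
proof -
  let ?A = "\<lambda>i j. h i (Poly_Mapping.single j (1::nat))"
  let ?U2 = "\<lambda>i. {u. h i u \<noteq> \<zero>\<^bsub>lhat_ring v\<^esub> \<and> 2 \<le> total_deg u}"
  define c' where "c' = \<rho> * real (Suc J)"
  define higher where
    "higher i = (\<Oplus>\<^bsub>lhat_ring v\<^esub>u\<in>?U2 i. h i u \<otimes>\<^bsub>lhat_ring v\<^esub> monomial s u)" for i
  define w where "w i = \<ominus>\<^bsub>lhat_ring v\<^esub> (h i 0 \<oplus>\<^bsub>lhat_ring v\<^esub> higher i)" for i
  have s_carrier: "s j \<in> carrier (lhat_ring v)" if "j \<in> I" for j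
    using s[OF that] by (rule approx_bounded_carrier)
  have A_carrier: "?A i j \<in> carrier (lhat_ring v)" if "i \<in> I" "j \<in> I" for i j
    using h1[OF that] by (rule slope_bounded_carrier)
  have h_carrier: "h i u \<in> carrier (lhat_ring v)" if i: "i \<in> I" for i u
  proof (cases "h i u = \<zero>\<^bsub>lhat_ring v\<^esub>")
    case False
    note keys = supp[OF i False]
    consider "total_deg u = 0" | "total_deg u = 1" | "2 \<le> total_deg u" by linarith
    then show ?thesis
    proof cases
      case 1
      then show ?thesis using h0[OF i] total_deg_eq_0D slope_bounded_carrier by metis
    next
      case 2
      then obtain j where j: "u = Poly_Mapping.single j 1" by (rule total_deg_eq_1D)
      with keys have "j \<in> I" by simp
      with j A_carrier[OF i] show ?thesis by simp
    next
      case 3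
      show ?thesis using h2[OF i keys 3] by (rule slope_bounded_carrier)
    qed
  qed simp
  have higher: "higher i \<in> approx_bounded al 0 \<kappa> c'" if i: "i \<in> I" for i
    unfolding higher_def
  proof (rule approx_bounded_finsum)
    fix u assume u: "u \<in> ?U2 i"
    then have keys: "Poly_Mapping.keys u \<subseteq> I" and deg: "2 \<le> total_deg u" using supp[OF i] by auto
    let ?l = "real (total_deg u)"
    have "monomial s u \<in> approx_bounded al (\<rho> * ?l) (\<kappa> * ?l) (\<rho> * (real J + ?l - 1))"
      using s keys by (intro approx_bounded_monomial) auto
    moreover have "h i u \<in> approx_bounded al 0 (\<kappa> - \<kappa> * ?l) c'"
      using h2[OF i keys deg] by (rule slope_bounded_imp_approx_bounded)
    ultimately have "h i u \<otimes>\<^bsub>lhat_ring v\<^esub> monomial s u \<in> approx_bounded al (0 + \<rho> * ?l)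
        (\<kappa> - \<kappa> * ?l + \<kappa> * ?l) (min (c' + \<rho> * ?l) (\<rho> * (real J + ?l - 1) + 0))"
      by (intro approx_bounded_mult)
    then show "h i u \<otimes>\<^bsub>lhat_ring v\<^esub> monomial s u \<in> approx_bounded al 0 \<kappa> c'"
    proof (rule approx_bounded_mono)
      \<comment> \<open>Degree at least two enters here: beside the factor that carries the error
        there is another of valuation at least \<rho>.\<close>
      have "c' \<le> \<rho> * (real J + ?l - 1)"
        unfolding c'_def using \<rho> deg by (intro mult_left_mono) auto
      then show "c' \<le> min (c' + \<rho> * ?l) (\<rho> * (real J + ?l - 1) + 0)" using \<rho> by simp
    qed (use \<rho> in auto)
  qed
  have w: "w i \<in> approx_bounded al 0 \<kappa> c'" if i: "i \<in> I" for i
    unfolding w_def using higher[OF i] slope_bounded_imp_approx_bounded[OF h0[OF i]]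
    by (intro approx_bounded_minus approx_bounded_add)
  have w_eq: "w i = (\<Oplus>\<^bsub>lhat_ring v\<^esub>j\<in>I. ?A i j \<otimes>\<^bsub>lhat_ring v\<^esub> s j)" if i: "i \<in> I" for i
  proof -
    let ?lin = "\<Oplus>\<^bsub>lhat_ring v\<^esub>j\<in>I. ?A i j \<otimes>\<^bsub>lhat_ring v\<^esub> s j"
    have closed: "h i 0 \<in> carrier (lhat_ring v)" "higher i \<in> carrier (lhat_ring v)" "?lin \<in> carrier (lhat_ring v)"
      using h_carrier[OF i] approx_bounded_carrier[OF higher[OF i]] A_carrier[OF i] s_carrier
      by (auto intro!: L.finsum_closed)
    have "h i 0 \<oplus>\<^bsub>lhat_ring v\<^esub> ?lin \<oplus>\<^bsub>lhat_ring v\<^esub> higher i = \<zero>\<^bsub>lhat_ring v\<^esub>"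
      using sol[OF i] sys_eval_split[OF I fin[OF i] supp[OF i] h_carrier[OF i] s_carrier]
      by (simp add: higher_def)
    then have "?lin \<oplus>\<^bsub>lhat_ring v\<^esub> (h i 0 \<oplus>\<^bsub>lhat_ring v\<^esub> higher i) = \<zero>\<^bsub>lhat_ring v\<^esub>"
      using closed by (simp add: L.a_ac)
    then show ?thesis unfolding w_def using closed by (intro L.minus_equality) auto
  qed
  have y: "y \<in> approx_bounded al \<rho> 0 (\<rho> * real J)" using det(3) by (rule slope_bounded_imp_approx_bounded)
  define D where "D = rdet (lhat_ring v) I (L.replace_col ?A k w)"
  have D: "D \<in> approx_bounded al 0 \<kappa> c'"
    unfolding D_def by (rule approx_bounded_rdet[OF I k h1 w])
  have "rdet (lhat_ring v) I ?A \<otimes>\<^bsub>lhat_ring v\<^esub> s k = D"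
    unfolding D_def by (rule L.cramer_rule[OF I k A_carrier s_carrier w_eq])
  moreover have "rdet (lhat_ring v) I ?A = (\<lambda>m. if m = 0 then r else 0) \<oplus>\<^bsub>lhat_ring v\<^esub> y"
    using det(1) by (simp add: lhat_ring_simps)
  moreover have r_carrier: "(\<lambda>m. if m = 0 then r else 0) \<in> carrier (lhat_ring v)"
    using det(2) lhat_const by (simp add: lhat_ring_simps)
  ultimately have *: "(\<lambda>m. if m = 0 then r else 0) \<otimes>\<^bsub>lhat_ring v\<^esub> s k
      \<oplus>\<^bsub>lhat_ring v\<^esub> y \<otimes>\<^bsub>lhat_ring v\<^esub> s k = D"
    using approx_bounded_carrier[OF y] s_carrier[OF k] by (simp add: L.l_distr)
  have rs: "(\<lambda>m. if m = 0 then r else 0) \<otimes>\<^bsub>lhat_ring v\<^esub> s k = (\<lambda>m. r * s k m)"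
    using lmult_const[of r "s k"] det(2) approx_bounded_lhat[OF s[OF k]] by (simp add: lhat_ring_simps)
  have "y \<otimes>\<^bsub>lhat_ring v\<^esub> s k \<in> approx_bounded al 0 \<kappa> c'"
  proof (rule approx_bounded_mono[OF approx_bounded_mult[OF y s[OF k]]])
    \<comment> \<open>The term contains \<open>s k\<close> itself, known only to precision \<rho> J;
      the bound \<rho> on \<open>y\<close> supplies what is missing.\<close>
    show "c' \<le> min (\<rho> * real J + \<rho>) (\<rho> * real J + \<rho>)" by (simp add: c'_def algebra_simps)
  qed (use \<rho> in auto)
  then have "D \<oplus>\<^bsub>lhat_ring v\<^esub> \<ominus>\<^bsub>lhat_ring v\<^esub> (y \<otimes>\<^bsub>lhat_ring v\<^esub> s k) \<in> approx_bounded al 0 \<kappa> c'"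
    by (intro approx_bounded_add approx_bounded_minus D)
  moreover have "D \<oplus>\<^bsub>lhat_ring v\<^esub> \<ominus>\<^bsub>lhat_ring v\<^esub> (y \<otimes>\<^bsub>lhat_ring v\<^esub> s k) = (\<lambda>m. r * s k m)"
    unfolding *[symmetric] rs[symmetric] using r_carrier approx_bounded_carrier[OF y] s_carrier[OF k]
    by (simp add: L.a_assoc L.r_neg)
  ultimately have "(\<lambda>m. r * s k m) \<in> approx_bounded al 0 \<kappa> c'" by simp
  \<comment> \<open>Since \<open>r\<close> is a unit constant, the bound for \<open>r\<close> times
    \<open>s k\<close> can be read off for \<open>s k\<close> without inverting a series.\<close>
  moreover have "v (r * s k m) = v (s k m)" for m using det(2) by (simp add: v_mult)
  ultimately have "ereal (min c' (\<kappa> - al * real_of_int m)) \<le> v (s k m)" for m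
    unfolding approx_bounded_def by (simp del: ereal_min)
  then show ?thesis using s[OF k] unfolding approx_bounded_def c'_def by blast
qed

text \<open>For fixed \<open>m\<close> the error term drops out of the minimum once \<rho> J exceeds
  the value of the line at \<open>m\<close>, so finitely many steps suffice for each
  coefficient.\<close>

theorem solution_bounded:
  fixes h :: "nat \<Rightarrow> (nat \<Rightarrow>\<^sub>0 nat) \<Rightarrow> int \<Rightarrow> 'k"
  assumes I: "finite I" and \<rho>: "0 < \<rho>"
    and fin: "\<And>i. i \<in> I \<Longrightarrow> finite {u. h i u \<noteq> \<zero>\<^bsub>lhat_ring v\<^esub>}"
    and supp: "\<And>i u. i \<in> I \<Longrightarrow> h i u \<noteq> \<zero>\<^bsub>lhat_ring v\<^esub> \<Longrightarrow> Poly_Mapping.keys u \<subseteq> I"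
    and h0: "\<And>i. i \<in> I \<Longrightarrow> h i 0 \<in> slope_bounded al 0 \<kappa>"
    and h1: "\<And>i j. i \<in> I \<Longrightarrow> j \<in> I \<Longrightarrow> h i (Poly_Mapping.single j 1) \<in> slope_bounded al 0 0"
    and h2: "\<And>i u. i \<in> I \<Longrightarrow> Poly_Mapping.keys u \<subseteq> I \<Longrightarrow> 2 \<le> total_deg u \<Longrightarrow>
      h i u \<in> slope_bounded al 0 (\<kappa> - \<kappa> * total_deg u)"
    and det: "rdet (lhat_ring v) I (\<lambda>i j. h i (Poly_Mapping.single j 1))
        = (\<lambda>m. (if m = 0 then r else 0) + y m)" "v r = 0" "y \<in> slope_bounded al \<rho> 0"
    and sol: "\<And>i. i \<in> I \<Longrightarrow> sys_eval v (h i) s = \<zero>\<^bsub>lhat_ring v\<^esub>"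
    and s: "\<And>i. i \<in> I \<Longrightarrow> s i \<in> lhat v" "\<And>i m. i \<in> I \<Longrightarrow> ereal \<rho> \<le> v (s i m)"
    and k: "k \<in> I"
  shows "ereal (\<kappa> - al * real_of_int m) \<le> v (s k m)"
proof -
  have approx: "\<forall>i\<in>I. s i \<in> approx_bounded al \<rho> \<kappa> (\<rho> * real J)" for J
  proof (induction J)
    case 0
    have "ereal (min (\<rho> * real 0) (\<kappa> - al * real_of_int m)) \<le> v (s i m)" if i: "i \<in> I" for i m
    proof -
      \<comment> \<open>At \<open>J = 0\<close> the error term is 0, so the minimum is at most 0 and
        divisibility by pi is more than enough.\<close>
      have "ereal (min (\<rho> * real 0) (\<kappa> - al * real_of_int m)) \<le> ereal \<rho>"
        unfolding ereal_less_eq using \<rho> by linarith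
      also have "\<dots> \<le> v (s i m)" by (rule s(2)[OF i])
      finally show ?thesis .
    qed
    then show ?case using s unfolding approx_bounded_def by blast
  next
    case (Suc J)
    show ?case
    proof
      fix i assume i: "i \<in> I"
      show "s i \<in> approx_bounded al \<rho> \<kappa> (\<rho> * real (Suc J))"
        by (rule solution_approx_step[where h = h and r = r and y = y, OF I \<rho>])
          (use fin supp h0 h1 h2 det sol Suc i in blast)+
    qed
  qed
  obtain J :: nat where "(\<kappa> - al * real_of_int m) / \<rho> \<le> real J" using real_arch_simple by blast
  then have J: "\<kappa> - al * real_of_int m \<le> \<rho> * real J" using \<rho> by (simp add: field_simps)
  have "ereal (min (\<rho> * real J) (\<kappa> - al * real_of_int m)) \<le> v (s k m)"
    using approx[of J] k unfolding approx_bounded_def by blast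
  then show ?thesis using J by (simp add: min_absorb2 del: ereal_min)
qed

text \<open>With positive slope the line tends to infinity as \<open>m\<close> tends to minus
  infinity, so the decay required by \<open>lhat\<close> comes for free.\<close>

lemma slope_boundedI:
  assumes al: "0 < al" and ge: "\<And>m. ereal c0 \<le> v (a m)" "0 \<le> c0"
    "\<And>m. ereal (\<beta> - al * real_of_int m) \<le> v (a m)"
  shows "a \<in> slope_bounded al c0 \<beta>"
proof -
  have "a \<in> lhat v" unfolding mem_lhat_iff
  proof safe
    have "0 \<le> ereal c0" using ge(2) by simp
    then show "0 \<le> v (a m)" for m using ge(1) by (rule order_trans)
    fix c :: real
    have "ereal c \<le> v (a m)" if "m < \<lfloor>(\<beta> - c) / al\<rfloor>" for m
    proof -
      have "real_of_int m \<le> (\<beta> - c) / al" using that by linarith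
      then have "ereal c \<le> ereal (\<beta> - al * real_of_int m)" using al by (simp add: field_simps)
      also have "\<dots> \<le> v (a m)" by (rule ge(3))
      finally show ?thesis .
    qed
    then show "\<exists>k. \<forall>m<k. ereal c \<le> v (a m)" by blast
  qed
  with ge show ?thesis by (simp add: slope_bounded_def)
qed

text \<open>Scaling by \<open>c\<close> raises the intercept -al d to x - al d, and
  \<open>le\<close> says that this is at least \<beta>.\<close>

lemma scale_by_bounded:
  assumes a: "a \<in> scale_by c B" and c: "v c = ereal x" "0 \<le> x" and al: "0 < al" and le: "al * d \<le> x - \<beta>"
    and B: "\<And>a m. a \<in> B \<Longrightarrow> 0 \<le> v (a m) \<and> ereal (- al * (real_of_int m + d)) \<le> v (a m)"
  shows "a \<in> slope_bounded al x \<beta>"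
proof -
  obtain a' where a': "a = (\<lambda>m. c * a' m)" "a' \<in> B" using a by (auto simp: scale_by_def)
  show ?thesis
  proof (rule slope_boundedI[OF al])
    fix m
    have "ereal x + 0 \<le> v (c * a' m)" using B[OF a'(2)] c by (intro v_mult_ge) auto
    then show "ereal x \<le> v (a m)" by (simp add: a'(1))
    have "ereal (\<beta> - al * real_of_int m) \<le> ereal x + ereal (- al * (real_of_int m + d))"
      using le by (simp add: algebra_simps)
    also have "\<dots> \<le> v (c * a' m)" using B[OF a'(2)] c by (intro v_mult_ge) auto
    finally show "ereal (\<beta> - al * real_of_int m) \<le> v (a m)" by (simp add: a'(1))
  qed (rule c)
qed

end

section \<open>The inequalities encoded by \<open>alpha_nu\<close>\<close>

lemma min_plus_le: "finite T \<Longrightarrow> y \<in> T \<Longrightarrow> 0 < y \<Longrightarrow> min_plus T \<le> y"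
  unfolding min_plus_def Let_def by (cases "y = \<infinity>") (auto intro!: Min_le)

lemma min_plus_pos: "finite T \<Longrightarrow> 0 < min_plus T"
  unfolding min_plus_def Let_def using Min_in[of "{y \<in> T. 0 < y \<and> y < \<infinity>}"] by auto

lemma alpha_nu_pos: assumes "0 < e" shows "0 < alpha_nu e N a b d \<nu>"
  unfolding alpha_nu_def using assms by (subst ereal_zero_less_0_iff) (auto intro!: min_plus_pos)

text \<open>For positive \<open>l\<close> this is the corresponding entry of the minimum with
  denominators cleared. For \<open>l \<le> 0\<close> the left side is not positive, which is why
  \<open>min_plus\<close> may skip the entry.\<close>

lemma alpha_nu_bound:
  assumes e: "0 < e" and al: "0 < al" "ereal al \<le> alpha_nu e N a b d \<nu>" and y: "0 < y"
    and mem: "frac_entry y l \<in> {frac_entry (of_nat b) (d 1), frac_entry (of_nat a - \<nu>) (d 0)} \<union>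
               {frac_entry (of_nat (l - 1) * \<nu>) (d l) | l. l \<in> {2..N}}" (is "_ \<in> ?T")
  shows "al * real_of_int l \<le> of_rat y / real e"
proof (cases "0 < l")
  case True
  have "finite ?T" by simp
  moreover have pos: "0 < real_of_rat (y / of_int l)" using True y by simp
  ultimately have "min_plus ?T \<le> frac_entry y l"
    using mem True by (intro min_plus_le) (auto simp: frac_entry_def)
  then have "ereal (1 / real e) * min_plus ?T \<le> ereal (1 / real e) * frac_entry y l"
    using e by (intro ereal_mult_left_mono) auto
  then have "ereal al \<le> ereal (1 / real e) * frac_entry y l" using al(2) unfolding alpha_nu_def by order
  then have "al \<le> real_of_rat y / real_of_int l / real e"
    using True by (simp add: frac_entry_def of_rat_divide mult.commute)
  then show ?thesis using True e by (simp add: field_simps)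
next
  case False
  have "al * real_of_int l \<le> 0" using False al(1) by (simp add: mult_nonneg_nonpos)
  also have "0 \<le> of_rat y / real e" using y by simp
  finally show ?thesis .
qed

text \<open>Serves both parts of the theorem: the coefficient sets enter only through the linear
  bound \<open>B\<close>. The slope \<open>al\<close> is any real number up to
  \<open>alpha_nu\<close>, so an infinite \<open>alpha_nu\<close> needs no separate
  argument.\<close>

lemma (in complete_valued_field) solution_in_R_ab:
  fixes H :: "nat \<Rightarrow> (nat \<Rightarrow>\<^sub>0 nat) \<Rightarrow> int \<Rightarrow> 'k"
  assumes e: "0 < e" and \<pi>: "v \<pi> = ereal (1 / real e)" and b: "0 < b"
    and fin: "\<And>i. i \<in> {2..n} \<Longrightarrow> finite {u. H i u \<noteq> \<zero>\<^bsub>lhat_ring v\<^esub>}"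
    and supp: "\<And>i u. i \<in> {2..n} \<Longrightarrow> H i u \<noteq> \<zero>\<^bsub>lhat_ring v\<^esub> \<Longrightarrow> Poly_Mapping.keys u \<subseteq> {2..n}"
    and N: "N = sys_degree v n H"
    and s_mem: "\<And>i. i \<in> {2..n} \<Longrightarrow> s i \<in> scale_by \<pi> (lhat v)"
    and s_sol: "\<And>i. i \<in> {2..n} \<Longrightarrow> sys_eval v (H i) s = \<zero>\<^bsub>lhat_ring v\<^esub>"
    and coeff: "coeff_bounds v \<pi> n N H a b B"
    and \<nu>: "0 < \<nu>" "\<nu> < of_nat a"
    and al: "0 < al" "ereal al \<le> alpha_nu e N a b d \<nu>"
    and B: "\<And>l g m. g \<in> B l \<Longrightarrow>
      0 \<le> v (g m) \<and> ereal (- al * (real_of_int m + real_of_int (d l))) \<le> v (g m)"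
    and k: "k \<in> {2..n}"
  shows "s k \<in> R_ab v al (of_rat \<nu> / real e)"
proof -
  let ?\<rho> = "1 / real e" and ?\<kappa> = "of_rat \<nu> / real e" and ?I = "{2..n}"
  have bound0: "al * real_of_int (d 0) \<le> of_rat (of_nat a - \<nu>) / real e"
    using \<nu> by (intro alpha_nu_bound[OF e al]) auto
  have bound1: "al * real_of_int (d 1) \<le> of_rat (of_nat b) / real e"
    using b by (intro alpha_nu_bound[OF e al]) auto
  have bound: "al * real_of_int (d l) \<le> of_rat (of_nat (l - 1) * \<nu>) / real e" if "l \<in> {2..N}" for l
    using \<nu> that by (intro alpha_nu_bound[OF e al]) auto
  have \<pi>_pow: "v (\<pi> ^ c) = ereal (real c / real e)" for c
    using v_power[OF \<pi>] by simp
  have pib: "y \<in> slope_bounded al ?\<rho> 0" if y: "y \<in> scale_by (\<pi> ^ b) (B 1)" for y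
  proof -
    have "y \<in> slope_bounded al (real b / real e) 0"
    proof (rule scale_by_bounded[OF y \<pi>_pow _ al(1)])
      show "al * real_of_int (d 1) \<le> real b / real e - 0" using bound1 by simp
    qed (use B in simp_all)
    \<comment> \<open>Since \<open>b\<close> is at least 1, \<open>y\<close> is divisible by pi, as
      the induction requires of the perturbation of the determinant.\<close>
    moreover have "?\<rho> \<le> real b / real e" using b e by (simp add: divide_right_mono)
    then have "ereal ?\<rho> \<le> ereal (real b / real e)" by simp
    ultimately show ?thesis unfolding slope_bounded_def by (blast intro: order_trans)
  qed
  have H0: "H i 0 \<in> slope_bounded al 0 ?\<kappa>" if i: "i \<in> ?I" for i
  proof -
    have mem: "H i 0 \<in> scale_by (\<pi> ^ a) (B 0)"
      using coeff i total_deg_zero unfolding coeff_bounds_def by simp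
    have "H i 0 \<in> slope_bounded al (real a / real e) ?\<kappa>"
    proof (rule scale_by_bounded[OF mem \<pi>_pow _ al(1)])
      show "al * real_of_int (d 0) \<le> real a / real e - ?\<kappa>"
        using bound0 by (simp add: of_rat_diff diff_divide_distrib)
    qed (use B in simp_all)
    moreover have "ereal 0 \<le> ereal (real a / real e)" by simp
    ultimately show ?thesis unfolding slope_bounded_def by (blast intro: order_trans)
  qed
  have H1: "H i (Poly_Mapping.single j 1) \<in> slope_bounded al 0 0" if i: "i \<in> ?I" and j: "j \<in> ?I" for i j
  proof -
    have "H i (Poly_Mapping.single j 1) \<in> const_plus (val_ring v) (scale_by (\<pi> ^ b) (B 1))"
      using coeff i j total_deg_single[of j] unfolding coeff_bounds_def by simp
    then obtain r y where ry: "H i (Poly_Mapping.single j 1) = (\<lambda>m. (if m = 0 then r else 0) + y m)"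
      "0 \<le> v r" "y \<in> scale_by (\<pi> ^ b) (B 1)"
      unfolding const_plus_def val_ring_def by blast
    note y = pib[OF ry(3)]
    show ?thesis unfolding ry(1)
    proof (rule slope_boundedI[OF al(1)])
      fix m
      have "ereal 0 \<le> ereal ?\<rho>" by simp
      also have "\<dots> \<le> v (y m)" using y by (simp add: slope_bounded_def)
      finally show "ereal 0 \<le> v ((if m = 0 then r else 0) + y m)"
        using ry(2) by (intro v_add_ge) (auto simp: zero_ereal_def)
      \<comment> \<open>The constant \<open>r\<close> contributes only at \<open>m = 0\<close>,
        where the line has the value 0.\<close>
      have "ereal (0 - al * real_of_int m) \<le> v (y m)" using y unfolding slope_bounded_def by blast
      then show "ereal (0 - al * real_of_int m) \<le> v ((if m = 0 then r else 0) + y m)"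
        using ry(2) by (intro v_add_ge) (auto simp: zero_ereal_def)
    qed simp
  qed
  have H2: "H i u \<in> slope_bounded al 0 (?\<kappa> - ?\<kappa> * total_deg u)"
    if i: "i \<in> ?I" and keys: "Poly_Mapping.keys u \<subseteq> ?I" and deg: "2 \<le> total_deg u" for i u
  \<comment> \<open>Zero satisfies every bound; this disposes of all degrees above
    \<open>N\<close>.\<close>
  proof (cases "H i u = \<zero>\<^bsub>lhat_ring v\<^esub>")
    case True
    then show ?thesis by (simp add: slope_bounded_def lhat_ring_simps lhat_zero)
  next
    case False
    then have l: "total_deg u \<in> {2..N}" using total_deg_le_sys_degree[of i n H u v] i fin deg N by auto
    then have mem: "H i u \<in> B (total_deg u)"
      using coeff i keys unfolding coeff_bounds_def by blast
    show ?thesis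
    proof (rule slope_boundedI[OF al(1)])
      fix m
      show "ereal 0 \<le> v (H i u m)" using B[OF mem] by (simp add: zero_ereal_def)
      \<comment> \<open>The entry (l - 1) \<nu> / d_l for l the total degree: it turns -al d_l into
        an intercept of at least (1 - l) \<nu>/e.\<close>
      have "al * real_of_int (d (total_deg u)) \<le> (real (total_deg u) - 1) * ?\<kappa>"
        using bound[OF l] deg by (simp add: of_rat_mult of_nat_diff of_rat_diff)
      then have "ereal (?\<kappa> - ?\<kappa> * real (total_deg u) - al * real_of_int m)
          \<le> ereal (- al * (real_of_int m + real_of_int (d (total_deg u))))"
        by (simp add: algebra_simps diff_divide_distrib)
      also have "\<dots> \<le> v (H i u m)" using B[OF mem] by blast
      finally show "ereal (?\<kappa> - ?\<kappa> * real (total_deg u) - al * real_of_int m) \<le> v (H i u m)" .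
    qed simp
  qed
  have "jac_det v n H \<in> const_plus {r. v r = 0} (scale_by (\<pi> ^ b) (B 1))"
    using coeff unfolding coeff_bounds_def by blast
  then obtain r y where det: "jac_det v n H = (\<lambda>m. (if m = 0 then r else 0) + y m)"
    "v r = 0" "y \<in> scale_by (\<pi> ^ b) (B 1)"
    unfolding const_plus_def by blast
  have s: "s i \<in> lhat v" "ereal ?\<rho> \<le> v (s i m)" if i: "i \<in> ?I" for i m
  proof -
    obtain g where g: "s i = (\<lambda>m. \<pi> * g m)" "g \<in> lhat v"
      using s_mem[OF i] by (auto simp: scale_by_def)
    show "s i \<in> lhat v" unfolding g(1) by (rule lhat_cmult[OF g(2)]) (simp add: \<pi>)
    have "ereal ?\<rho> + 0 \<le> v (\<pi> * g m)" using lhat_nonneg[OF g(2)] by (intro v_mult_ge) (simp_all add: \<pi>)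
    then show "ereal ?\<rho> \<le> v (s i m)" by (simp add: g(1))
  qed
  have "ereal (?\<kappa> - al * real_of_int m) \<le> v (s k m)" for m
  proof (rule solution_bounded[where h = H and I = ?I and \<rho> = ?\<rho> and r = r and y = y])
    show "rdet (lhat_ring v) ?I (\<lambda>i j. H i (Poly_Mapping.single j 1)) = (\<lambda>m. (if m = 0 then r else 0) + y m)"
      using det(1) by (simp only: jac_det_def)
    show "y \<in> slope_bounded al ?\<rho> 0" by (rule pib[OF det(3)])
  qed (use e fin supp H0 H1 H2 det(2) s_sol s k in \<open>simp_all del: One_nat_def\<close>)
  then show ?thesis
    using lhat_nonneg[OF s(1)[OF k]] by (simp add: R_ab_def val_ring_def algebra_simps)
qed

text \<open>Coefficients vanish below index \<open>-d\<close>, and from there on the line is at most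
  0. This works for every positive slope, so in part (1) only \<open>alpha_nu\<close> limits
  \<open>al\<close>.\<close>

lemma (in valued_field) t_shift_pow_ser_bound:
  assumes g: "g \<in> t_shift d (pow_ser v)" and al: "0 < al"
  shows "0 \<le> v (g m) \<and> ereal (- al * (real_of_int m + real_of_int d)) \<le> v (g m)"
proof -
  obtain g' where g': "g = (\<lambda>m. g' (m + d))" "\<And>m. 0 \<le> v (g' m)" "\<And>m. m < 0 \<Longrightarrow> g' m = 0"
    using g by (auto simp: t_shift_def pow_ser_def val_ring_def)
  show ?thesis
  proof (cases "m + d < 0")
    case False
    then have "- al * (real_of_int m + real_of_int d) \<le> 0"
      using al by (simp add: mult_nonneg_nonneg flip: of_int_add)
    then have "ereal (- al * (real_of_int m + real_of_int d)) \<le> 0" by (simp add: zero_ereal_def)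
    also have "0 \<le> v (g m)" by (simp add: g')
    finally show ?thesis by (simp add: g')
  qed (simp add: g')
qed

text \<open>Both lines vanish at \<open>m = -d\<close>. To the left the flatter one lies below the
  steeper one, and to the right integrality suffices. The condition \<open>al \<le> \<alpha>\<close>
  is the origin of the minimum of \<alpha> and \<open>alpha_nu\<close> in part (2).\<close>

lemma R_ab_bound:
  assumes g: "g \<in> R_ab v \<alpha> (- (real_of_int d * \<alpha>))" and al: "0 < al" "al \<le> \<alpha>"
  shows "0 \<le> v (g m) \<and> ereal (- al * (real_of_int m + real_of_int d)) \<le> v (g m)"
proof -
  have nonneg: "0 \<le> v (g m)" and ge: "ereal (- \<alpha> * (real_of_int m + real_of_int d)) \<le> v (g m)"
    using g by (simp_all add: R_ab_def val_ring_def distrib_left mult.commute[of \<alpha> "real_of_int d"])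
  show ?thesis
  proof (cases "0 \<le> real_of_int m + real_of_int d")
    case True
    then have "ereal (- al * (real_of_int m + real_of_int d)) \<le> 0" using al by (simp add: zero_ereal_def)
    with nonneg show ?thesis by (blast intro: order_trans)
  next
    case False
    then have "ereal (- al * (real_of_int m + real_of_int d)) \<le> ereal (- \<alpha> * (real_of_int m + real_of_int d))"
      using al(2) by (simp add: mult_right_mono_neg)
    with nonneg ge show ?thesis by (blast intro: order_trans)
  qed
qed

theorem theorem5p14:
  fixes p e p' n N :: nat
    and v :: "'k::field_char_0 \<Rightarrow> ereal"
    and \<pi> :: 'k
    and red :: "'k \<Rightarrow> 'r::field"
    and \<sigma> :: "'k \<Rightarrow> 'k"
    and \<iota> :: "'k \<Rightarrow> 'f::field"
    and C :: "'f set set"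
    and x :: "nat \<Rightarrow> 'f"
    and f :: "nat \<Rightarrow> 'k mpoly"
    and P :: "nat \<Rightarrow> nat \<Rightarrow> 'k mpoly"
    and \<Delta> :: "nat \<Rightarrow> nat \<Rightarrow> nat \<Rightarrow> 'k mpoly"
    and q :: "'f set"
    and ev :: "'f \<Rightarrow> 'k"
    and t :: 'f
    and H :: "nat \<Rightarrow> (nat \<Rightarrow>\<^sub>0 nat) \<Rightarrow> int \<Rightarrow> 'k"
    and s :: "nat \<Rightarrow> int \<Rightarrow> 'k"
  assumes setting: "curve_setting p e p' v \<pi> red \<sigma> \<iota> C n x f P \<Delta> q ev t"
    and H: "H = H_system v \<pi> \<sigma> p' \<iota> n x f P \<Delta> q t"
    and N: "N = sys_degree v n H"
    and s_mem: "\<And>i. i \<in> {2..n} \<Longrightarrow> s i \<in> scale_by \<pi> (lhat v)"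
    and s_sol: "\<And>i. i \<in> {2..n} \<Longrightarrow> sys_eval v (H i) s = \<zero>\<^bsub>lhat_ring v\<^esub>"
  shows
    "(\<forall>(a::nat) (b::nat) (d::nat \<Rightarrow> int).
        0 < a \<and> 0 < b \<and> coeff_bounds v \<pi> n N H a b (\<lambda>l. t_shift (d l) (pow_ser v)) \<longrightarrow>
        (\<forall>\<nu>::rat. 0 < \<nu> \<and> \<nu> < of_nat a \<longrightarrow>
          (\<forall>i\<in>{2..n}.
            (if alpha_nu e N a b d \<nu> = \<infinity>
             then \<forall>\<alpha>::rat. 0 < \<alpha> \<longrightarrow> s i \<in> R_ab v (of_rat \<alpha>) (of_rat \<nu> / real e)
             else s i \<in> R_ab v (real_of_ereal (alpha_nu e N a b d \<nu>)) (of_rat \<nu> / real e)))))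
     \<and>
     (\<forall>(\<alpha>::rat) (a::nat) (b::nat) (d::nat \<Rightarrow> int).
        0 < \<alpha> \<and> 0 < a \<and> 0 < b \<and>
        coeff_bounds v \<pi> n N H a b
          (\<lambda>l. R_ab v (of_rat \<alpha>) (- (real_of_int (d l) * of_rat \<alpha>))) \<longrightarrow>
        (\<forall>\<nu>::rat. 0 < \<nu> \<and> \<nu> < of_nat a \<longrightarrow>
          (\<forall>i\<in>{2..n}.
            s i \<in> R_ab v (real_of_ereal (min (ereal (of_rat \<alpha>)) (alpha_nu e N a b d \<nu>)))
                         (of_rat \<nu> / real e))))"
proof -
  interpret curve_setting p e p' v \<pi> red \<sigma> \<iota> C n x f P \<Delta> q ev t by (rule setting)
  interpret complete_valued_field v by (rule padic_Galois_field_complete[OF base_field])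
  have "v (\<pi> ^ e) = 1" using ramification base_field by (simp add: padic_Galois_field_def)
  moreover obtain r where r: "v \<pi> = ereal r"
    using uniformizer v_real unfolding is_uniformizer_def by metis
  \<comment> \<open>Ramification reads e v(pi) = v(p) = 1, which fixes the valuation of pi and also
    excludes \<open>e = 0\<close>.\<close>
  ultimately have er: "real e * r = 1" using v_power[OF r, of e] by simp
  then have e: "0 < e" by (cases "e = 0") auto
  have \<pi>: "v \<pi> = ereal (1 / real e)" using r er e by (simp add: field_simps)
  have fin: "finite {u. H i u \<noteq> \<zero>\<^bsub>lhat_ring v\<^esub>}" for i
    unfolding H by (rule finite_H_system)
  have supp: "Poly_Mapping.keys u \<subseteq> {2..n}" if "H i u \<noteq> \<zero>\<^bsub>lhat_ring v\<^esub>" for i u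
    using H_system_nonzeroD(2)[OF that[unfolded H]] .
  have part1: "s i \<in> R_ab v al (of_rat \<nu> / real e)"
    if "0 < b" "coeff_bounds v \<pi> n N H a b (\<lambda>l. t_shift (d l) (pow_ser v))" "0 < \<nu>" "\<nu> < of_nat a"
      "i \<in> {2..n}" "0 < al" "ereal al \<le> alpha_nu e N a b d \<nu>" for a b d \<nu> i al
    by (rule solution_in_R_ab[OF e \<pi> that(1) _ _ N _ _ that(2,3,4,6,7) _ that(5)])
      (use fin supp s_mem s_sol t_shift_pow_ser_bound[OF _ that(6)] in blast)+
  have part2: "s i \<in> R_ab v al (of_rat \<nu> / real e)"
    if "0 < b" "coeff_bounds v \<pi> n N H a b (\<lambda>l. R_ab v \<alpha> (- (real_of_int (d l) * \<alpha>)))"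
      "0 < \<nu>" "\<nu> < of_nat a"
      "i \<in> {2..n}" "0 < al" "ereal al \<le> alpha_nu e N a b d \<nu>" "al \<le> \<alpha>" for a b d \<alpha> \<nu> i al
    by (rule solution_in_R_ab[OF e \<pi> that(1) _ _ N _ _ that(2,3,4,6,7) _ that(5)])
      (use fin supp s_mem s_sol R_ab_bound[OF _ that(6,8)] in blast)+
  show ?thesis
  proof (intro conjI allI impI ballI; (elim conjE)?)
    fix a b :: nat and d :: "nat \<Rightarrow> int" and \<nu> :: rat and i
    assume *: "0 < b" "coeff_bounds v \<pi> n N H a b (\<lambda>l. t_shift (d l) (pow_ser v))"
      "0 < \<nu>" "\<nu> < of_nat a" "i \<in> {2..n}"
    show "if alpha_nu e N a b d \<nu> = \<infinity>
        then \<forall>\<alpha>::rat. 0 < \<alpha> \<longrightarrow> s i \<in> R_ab v (of_rat \<alpha>) (of_rat \<nu> / real e)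
        else s i \<in> R_ab v (real_of_ereal (alpha_nu e N a b d \<nu>)) (of_rat \<nu> / real e)"
    proof (cases "alpha_nu e N a b d \<nu>")
      case (real al)
      then have "0 < al" using alpha_nu_pos[OF e, of N a b d \<nu>] by simp
      with real part1[OF *, of al] show ?thesis by simp
    \<comment> \<open>Positivity of \<open>alpha_nu\<close> excludes minus infinity; at infinity
      \<open>part1\<close> accepts every positive rational slope.\<close>
    qed (use part1[OF *] alpha_nu_pos[OF e, of N a b d \<nu>] in auto)
  next
    fix \<alpha> :: rat and a b :: nat and d :: "nat \<Rightarrow> int" and \<nu> :: rat and i
    assume *: "0 < b" "coeff_bounds v \<pi> n N H a b
        (\<lambda>l. R_ab v (of_rat \<alpha>) (- (real_of_int (d l) * of_rat \<alpha>)))"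
      "0 < \<nu>" "\<nu> < of_nat a" "i \<in> {2..n}"
      and \<alpha>: "0 < \<alpha>"
    let ?m = "min (ereal (of_rat \<alpha>)) (alpha_nu e N a b d \<nu>)"
    \<comment> \<open>The minimum lies above 0 and is at most \<alpha>, so it is a real number and
      \<open>real_of_ereal\<close> returns its true value.\<close>
    have "0 < ?m" using \<alpha> alpha_nu_pos[OF e] by (simp add: min_def)
    moreover have "?m \<le> ereal (of_rat \<alpha>)" by simp
    ultimately obtain al where al: "?m = ereal al" by (cases ?m) auto
    have "0 < al" "al \<le> of_rat \<alpha>" "ereal al \<le> alpha_nu e N a b d \<nu>"
      using \<open>0 < ?m\<close> \<open>?m \<le> _\<close> min.cobounded2[of "ereal (of_rat \<alpha>)" "alpha_nu e N a b d \<nu>"]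
      unfolding al by simp_all
    then show "s i \<in> R_ab v (real_of_ereal ?m) (of_rat \<nu> / real e)"
      unfolding al using part2[OF *, of al] by simp
  qed
qed

end
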